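(* Let $f\in\mathcal{C}^2(\mathbb{R}^2)$ be supported in $\mathbb{B}^\circ$ and let $(m,n)\in\mathbb{Z}\times\mathbb{N}$. Then $$\left|C_{m,n}(f)-C_{m,n}^{K}(f)\right|=\mathcal{O}(1/K)\qquad\text{for } K\ge K_{m,n},$$ that is, there is a constant $A>0$ such that $|C_{m,n}(f)-C_{m,n}^K(f)|\le A/K$ for every $K\in\mathbb{N}$ with $K\ge K_{m,n}$.
   Context: $\mathbb{N}=\{1,2,\dots\}$. $\mathbb{B}^\circ$ is the open unit disk of $\mathbb{R}^2$; $\mathrm{supp}(f)=\{\mathbf{x}: f(\mathbf{x})\neq 0\}$ and $f$ is supported in $X$ if $\mathrm{supp}(f)\subseteq X$. $\mathcal{C}^q(\mathbb{R}^2)$ is the set of functions $\mathbb{R}^2\to\mathbb{C}$ all of whose partial derivatives of order $\le q$ exist and are continuous. Bessel notation: $J_m$ is the Bessel function of the first kind of order $m\in\mathbb{Z}$, $0<z_{m,1}<z_{m,2}<\cdots$ are its positive zeros, and $K_{m,n}:=\lceil z_{m,n}/\pi\rceil$. In polar coordinates, $\Psi_{m,n}(r,\theta)=\frac{e^{\mathrm{i}m\theta}J_m(z_{m,n}r)}{\sqrt{\pi}\,|J_{m+1}(z_{m,n})|}$ if $r\le 1$, and $0$ if $r>1$. The Fourier-Bessel coefficient is $C_{m,n}(f)=\int_0^{2\pi}\int_0^1 f(r,\theta)\overline{\Psi_{m,n}(r,\theta)}\,r\,dr\,d\theta$. Finite Fourier transform: for $L\in\mathbb{N}$, $\mathbf{k}\in\mathbb{Z}^2$,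 $\widehat f(\mathbf{k};L)=\delta^2\sum_{i=1}^L\sum_{j=1}^L f(x_i,x_j)e^{-\pi\mathrm{i}(k_1x_i+k_2x_j)}$ with $\delta=2/L$, $x_i=-1+(i-1)\delta$. Coefficients: for $\mathbf{k}=(k_1,k_2)\in\mathbb{Z}^2$, $\mathbf{c}(\mathbf{k};m,n)=\varepsilon_m\sqrt{\pi}(-1)^n\mathrm{i}^m z_{m,n}\frac{J_m(\pi\|\mathbf{k}\|_2)e^{-\mathrm{i}m\Phi(\mathbf{k})}}{2(\pi^2\|\mathbf{k}\|_2^2-z_{m,n}^2)}$, where $\varepsilon_m=1$ if $m\ge0$, $\varepsilon_m=(-1)^m$ if $m<0$, and $\Phi(\mathbf{k})=\mathrm{atan2}(k_2,k_1)$ is the polar angle of $\mathbf{k}$ (with value $0$ at $\mathbf{k}=0$). If $\pi\|\mathbf{k}\|_2=z_{m,n}$, the quotient $J_m(\pi\|\mathbf{k}\|_2)/(\pi^2\|\mathbf{k}\|_2^2-z_{m,n}^2)$ is understood as its limiting value $J_m'(z_{m,n})/(2z_{m,n})$. Finite Fourier-Bessel transform of order $K\in\mathbb{N}$: $C_{m,n}^K(f)=\sum_{\mathbf{k}\in\mathbb{Z}^2,\ \|\mathbf{k}\|_\infty\le K}\mathbf{c}(\mathbf{k};m,n)\,\widehat f(\mathbf{k};2K+1)$. *)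

theory Defs
  imports "HOL-Analysis.Analysis"
begin

text \<open>
  The factor \<open>rGamma\<close> (the reciprocal Gamma function, zero at the non-positive integers) kills
  the terms with \<open>k + m < 0\<close>, hence all terms with a negative power of \<open>x\<close>; so for negative
  \<open>m\<close> this is \<open>(-1)^m\<close> times the function of order \<open>-m\<close>.
\<close>
definition bessel_J :: "int \<Rightarrow> real \<Rightarrow> real" where
  "bessel_J m x =
     (\<Sum>k. (-1) ^ k / fact k * rGamma (real_of_int (int k + m + 1)) * (x / 2) powi (2 * int k + m))"

text \<open>
  The \<open>n\<close>-th positive zero for \<open>n \<ge> 1\<close>: the zero \<open>z > 0\<close> such that exactly \<open>n\<close> zeros
  lie in \<open>(0, z]\<close>. (As \<open>card\<close> is \<open>0\<close> on infinite sets, \<open>n \<ge> 1\<close> forces finiteness.)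
\<close>
definition bessel_zero :: "int \<Rightarrow> nat \<Rightarrow> real" where
  "bessel_zero m n =
     (THE z. 0 < z \<and> bessel_J m z = 0 \<and> card {x. 0 < x \<and> x \<le> z \<and> bessel_J m x = 0} = n)"

definition K_min :: "int \<Rightarrow> nat \<Rightarrow> int" where
  "K_min m n = \<lceil>bessel_zero m n / pi\<rceil>"

text \<open>All partial derivatives of order at most \<open>q\<close> exist and are continuous; \<open>f1\<close> and
  \<open>f2\<close> are the (necessarily unique) first-order partial derivatives of \<open>f\<close>.\<close>
primrec C_diff :: "nat \<Rightarrow> (real \<times> real \<Rightarrow> complex) \<Rightarrow> bool" where
  "C_diff 0 f \<longleftrightarrow> continuous_on UNIV f"
| "C_diff (Suc q) f \<longleftrightarrow> continuous_on UNIV f \<and>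
     (\<exists>f1 f2.
        (\<forall>x y. ((\<lambda>t. f (t, y)) has_vector_derivative f1 (x, y)) (at x)) \<and>
        (\<forall>x y. ((\<lambda>t. f (x, t)) has_vector_derivative f2 (x, y)) (at y)) \<and>
        C_diff q f1 \<and> C_diff q f2)"

definition supp :: "(real \<times> real \<Rightarrow> complex) \<Rightarrow> (real \<times> real) set" where
  "supp f = {x. f x \<noteq> 0}"

text \<open>In polar coordinates.\<close>
definition FB_Psi :: "int \<Rightarrow> nat \<Rightarrow> real \<Rightarrow> real \<Rightarrow> complex" where
  "FB_Psi m n r \<theta> =
     (if r \<le> 1 then
        exp (\<i> * of_int m * of_real \<theta>) * of_real (bessel_J m (bessel_zero m n * r))
          / of_real (sqrt pi * \<bar>bessel_J (m + 1) (bessel_zero m n)\<bar>)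
      else 0)"

definition FB_coeff :: "int \<Rightarrow> nat \<Rightarrow> (real \<times> real \<Rightarrow> complex) \<Rightarrow> complex" where
  "FB_coeff m n f =
     integral {0..2 * pi} (\<lambda>\<theta>. integral {0..1} (\<lambda>r.
       f (r * cos \<theta>, r * sin \<theta>) * cnj (FB_Psi m n r \<theta>) * of_real r))"

definition grid_step :: "nat \<Rightarrow> real" where
  "grid_step L = 2 / real L"

definition grid_point :: "nat \<Rightarrow> nat \<Rightarrow> real" where
  "grid_point L i = -1 + (real i - 1) * grid_step L"

definition finite_fourier :: "(real \<times> real \<Rightarrow> complex) \<Rightarrow> int \<times> int \<Rightarrow> nat \<Rightarrow> complex" where
  "finite_fourier f k L =
     of_real ((grid_step L)\<^sup>2) * (\<Sum>i=1..L. \<Sum>j=1..L.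
       f (grid_point L i, grid_point L j) *
       exp (- (of_real pi * \<i> *
         of_real (real_of_int (fst k) * grid_point L i + real_of_int (snd k) * grid_point L j))))"

definition freq_norm :: "int \<times> int \<Rightarrow> real" where
  "freq_norm k = norm (real_of_int (fst k), real_of_int (snd k))"

text \<open>\<open>atan2\<close> of the second and first component; \<open>Arg\<close> takes values in \<open>(-pi, pi]\<close> and
  \<open>Arg 0 = 0\<close>.\<close>
definition freq_angle :: "int \<times> int \<Rightarrow> real" where
  "freq_angle k = Arg (Complex (real_of_int (fst k)) (real_of_int (snd k)))"

definition bessel_sign :: "int \<Rightarrow> real" where
  "bessel_sign m = (if m \<ge> 0 then 1 else (-1) powi m)"

text \<open>The first branch is the limit of the second one at the removable singularity.\<close>
definition bessel_quotient :: "int \<Rightarrow> nat \<Rightarrow> real \<Rightarrow> real" where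
  "bessel_quotient m n \<kappa> =
     (let z = bessel_zero m n in
      if \<kappa> = z then deriv (bessel_J m) z / (2 * z)
      else bessel_J m \<kappa> / (\<kappa>\<^sup>2 - z\<^sup>2))"

definition FFB_weight :: "int \<times> int \<Rightarrow> int \<Rightarrow> nat \<Rightarrow> complex" where
  "FFB_weight k m n =
     of_real (bessel_sign m * sqrt pi * (-1) ^ n) * \<i> powi m * of_real (bessel_zero m n) *
     of_real (bessel_quotient m n (pi * freq_norm k)) *
     exp (- (\<i> * of_int m * of_real (freq_angle k))) / 2"

definition FFB_coeff :: "nat \<Rightarrow> int \<Rightarrow> nat \<Rightarrow> (real \<times> real \<Rightarrow> complex) \<Rightarrow> complex" where
  "FFB_coeff K m n f =
     (\<Sum>k \<in> {k. max \<bar>fst k\<bar> \<bar>snd k\<bar> \<le> int K}.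
        FFB_weight k m n * finite_fourier f k (2 * K + 1))"

end

theory Submission
  imports Defs
begin

text \<open>
  Let \<open>D\<close> be the difference of the two functionals. Both are linear, and they agree on the
  characters \<open>exp (\<i> * pi * (k \<bullet> x))\<close> with \<open>k\<close> in the box of size \<open>K\<close>: the finite transform by
  orthogonality on the grid, the Fourier-Bessel coefficient by the integral representation of
  \<open>J\<^sub>m\<close> and Lommel's integral, where the sign \<open>(-1)\<^sup>n\<close> comes from the alternation of the simple
  zeros of \<open>J\<^sub>m\<close>. Hence \<open>D f = D (f - p)\<close> for every trigonometric polynomial \<open>p\<close> with frequencies
  in the box. Sampling \<open>f\<close> against a Fejer-Korovkin kernel on the same grid gives such a \<open>p\<close> with
  \<open>f - p\<close> of size \<open>1/K\<close>, because \<open>f\<close> is Lipschitz for the periodic distance. Finally \<open>D\<close> is bounded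
  in the supremum norm uniformly in \<open>K\<close>, since the weights are square summable.
\<close>

section \<open>Integral representation of the Bessel functions\<close>

text \<open>The rate hinges on the choice of kernel. Plain trigonometric interpolation on the grid
  has sup norms growing with \<open>K\<close>, and Fejer's kernel has a first absolute moment of
  order \<open>log K / K\<close>; either would cost a logarithm. The Fejer-Korovkin kernel is
  nonnegative and its cosine moment is exactly \<open>cos (pi / (K + 2))\<close>, so its second
  moment is of order \<open>1/K\<^sup>2\<close>, and Cauchy-Schwarz makes the first moment of order
  \<open>1/K\<close>. Sums over the grid give the same moments as integrals would, since all
  frequencies involved stay below \<open>2 * K + 1\<close>. Stability has a similar obstacle. With
  \<open>\<bar>bessel_J m x\<bar> \<le> 1\<close> the weights are only seen to decay like
  \<open>1 / (freq_norm k)\<^sup>2\<close>, which is not summable over the planar lattice, so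
  estimating the finite transform term by term would lose a logarithm again. Passing to squares
  through the discrete Parseval identity avoids this.\<close>

lemma integral_suminf_sums:
  fixes g :: "nat \<Rightarrow> real \<Rightarrow> complex"
  assumes "\<And>n. continuous_on {a..b} (g n)"
    and "\<And>n t. t \<in> {a..b} \<Longrightarrow> norm (g n t) \<le> M n"
    and "summable M"
  shows "(\<lambda>n. integral {a..b} (g n)) sums integral {a..b} (\<lambda>t. \<Sum>n. g n t)"
proof -
  have u: "uniform_limit {a..b} (\<lambda>n t. \<Sum>i<n. g i t) (\<lambda>t. \<Sum>n. g n t) sequentially"
    by (rule Weierstrass_m_test) (use assms in auto)
  have c: "continuous_on {a..b} (\<lambda>t. \<Sum>i<n. g i t)" for n
    by (intro continuous_intros assms)
  obtain I J where I: "\<And>n. ((\<lambda>t. \<Sum>i<n. g i t) has_integral I n) {a..b}"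
    and J: "((\<lambda>t. \<Sum>n. g n t) has_integral J) {a..b}" and lim: "I \<longlonglongrightarrow> J"
    using uniform_limit_integral[OF u c] by (metis (no_types) sequentially_bot)
  have "I = (\<lambda>n. \<Sum>i<n. integral {a..b} (g i))"
  proof
    show "I n = (\<Sum>i<n. integral {a..b} (g i))" for n
      using integral_unique[OF I[of n]]
      by (subst (asm) integral_sum) (auto intro!: integrable_continuous_real assms)
  qed
  then show ?thesis
    using lim integral_unique[OF J] by (simp add: sums_def)
qed

lemma has_vector_derivative_cis [derivative_intros]:
  assumes "(g has_real_derivative g') (at x within S)"
  shows "((\<lambda>x. cis (g x)) has_vector_derivative (\<i> * of_real g' * cis (g x))) (at x within S)"
  unfolding has_vector_derivative_complex_iff
  using assms by (auto intro!: derivative_eq_intros)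

lemma integral_cis_period:
  fixes p :: int
  shows   "integral {0..2*pi} (\<lambda>\<theta>. cis (real_of_int p * \<theta>)) = (if p = 0 then 2 * pi else 0)"
proof (cases "p = 0")
  case False
  have "((\<lambda>\<theta>. cis (real_of_int p * \<theta>)) has_integral
      cis (real_of_int p * (2 * pi)) / (\<i> * of_int p) - cis (real_of_int p * 0) / (\<i> * of_int p)) {0..2*pi}"
  proof (rule fundamental_theorem_of_calculus)
    show "((\<lambda>\<theta>. cis (real_of_int p * \<theta>) / (\<i> * of_int p)) has_vector_derivative cis (real_of_int p * \<theta>))
        (at \<theta> within {0..2*pi})" for \<theta> :: real
      using False
      by (auto intro!: derivative_eq_intros has_vector_derivative_divide)
  qed simp
  moreover have "cis (real_of_int p * (2 * pi)) = 1"
    using cis_multiple_2pi[of "of_int p"] by (simp add: mult_ac)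
  ultimately show ?thesis
    using False by (simp add: integral_unique)
qed (simp add: scaleR_conv_of_real)

text \<open>Of the Taylor series of \<open>exp\<close> only the term of order \<open>q\<close>
  survives orthogonality. For \<open>q < 0\<close> there is no such term, and \<open>rGamma\<close>
  vanishes at \<open>q + 1 \<le> 0\<close>, so one formula in the shape of \<open>bessel_J\<close>
  covers all integers.\<close>

lemma integral_exp_cis:
  fixes u :: complex and q :: int
  shows "integral {0..2*pi} (\<lambda>\<theta>. exp (u * cis \<theta>) * cis (- (real_of_int q * \<theta>)))
     = 2 * pi * of_real (rGamma (real_of_int (q + 1))) * u powi q"
proof -
  define g where "g = (\<lambda>j \<theta>. (u ^ j / fact j) * cis (real_of_int (int j - q) * \<theta>))"
  have *: "(\<Sum>j. g j \<theta>) = exp (u * cis \<theta>) * cis (- (q * \<theta>))" for \<theta> :: real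
  proof -
    have "(\<lambda>j. (u * cis \<theta>) ^ j /\<^sub>R fact j * cis (- (q * \<theta>))) sums (exp (u * cis \<theta>) * cis (- (q * \<theta>)))"
      by (intro sums_mult2 exp_converges)
    moreover have "(u * cis \<theta>) ^ j /\<^sub>R fact j * cis (- (q * \<theta>)) = g j \<theta>" for j
    proof -
      have "cis \<theta> ^ j * cis (- (q * \<theta>)) = cis (real_of_int (int j - q) * \<theta>)"
        by (simp only: Complex.DeMoivre cis_mult) (simp add: algebra_simps)
      then show ?thesis
        by (simp add: g_def scaleR_conv_of_real power_mult_distrib divide_inverse mult_ac)
    qed
    ultimately show ?thesis
      by (simp add: sums_iff)
  qed
  have "(\<lambda>j. integral {0..2*pi} (g j)) sums integral {0..2*pi} (\<lambda>\<theta>. \<Sum>j. g j \<theta>)"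
    using summable_exp_generic[of "norm u"]
    by (intro integral_suminf_sums[where M = "\<lambda>j. norm u ^ j / fact j"])
       (auto intro!: continuous_intros
         simp: g_def norm_mult norm_divide norm_power norm_inverse divide_inverse mult.commute)
  moreover have "integral {0..2*pi} (g j) = (if int j = q then 2 * pi * u ^ j / fact j else 0)" for j
    unfolding g_def integral_mult_right using integral_cis_period[of "int j - q"] by simp
  ultimately have s: "(\<lambda>j. if int j = q then 2 * pi * u ^ j / fact j else 0) sums
      integral {0..2*pi} (\<lambda>\<theta>. exp (u * cis \<theta>) * cis (- (q * \<theta>)))"
    by (simp add: *)
  show ?thesis
  proof (cases "q \<ge> 0")
    case True
    then obtain k where k: "q = int k"
      using nonneg_int_cases by blast
    have "rGamma (real_of_int (q + 1)) = inverse (fact k)"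
      using Gamma_fact[of k, where 'a = real] by (simp add: k rGamma_inverse_Gamma add_ac)
    then show ?thesis
      using sums_unique2[OF s] sums_single[of k "\<lambda>j. 2 * pi * u ^ j / fact j"]
      by (simp add: k divide_inverse mult_ac)
  next
    case False
    then have "rGamma (real_of_int (q + 1)) = 0"
      unfolding rGamma_eq_zero_iff by (intro nonpos_Ints_of_int) auto
    moreover have "(\<lambda>j. if int j = q then 2 * pi * u ^ j / fact j else 0) sums 0"
      using False by auto
    ultimately show ?thesis
      using sums_unique2[OF s] by simp
  qed
qed

text \<open>This is the generating function of the Bessel functions; the rotation
  \<open>\<phi>\<close> will be the polar angle of a frequency. Only the factor
  \<open>exp (v * cis (- \<theta>))\<close> is expanded, while the other one is integrated by
  \<open>integral_exp_cis\<close>. So a single series appears, and it is the defining one.\<close>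

lemma bessel_J_integral:
  "integral {0..2*pi} (\<lambda>\<theta>. cis (x * cos (\<theta> - \<phi>) - real_of_int m * \<theta>))
     = 2 * pi * \<i> powi m * cis (- (m * \<phi>)) * of_real (bessel_J m x)"
  (is "?I = _")
proof -
  define u where "u = \<i> * of_real (x / 2) * cis (- \<phi>)"
  define v where "v = \<i> * of_real (x / 2) * cis \<phi>"
  define g where "g = (\<lambda>b \<theta>. (v ^ b / fact b) * (exp (u * cis \<theta>) * cis (- (real_of_int (int b + m) * \<theta>))))"
  have gen: "cis (x * cos (\<theta> - \<phi>)) = exp (u * cis \<theta>) * exp (v * cis (- \<theta>))" for \<theta> :: real
  proof -
    have "u * cis \<theta> + v * cis (- \<theta>) = \<i> * of_real (x * cos (\<theta> - \<phi>))"
      by (simp add: u_def v_def complex_eq_iff cos_diff field_simps)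
    then show ?thesis
      by (metis cis_conv_exp exp_add)
  qed
  have *: "(\<Sum>b. g b \<theta>) = cis (x * cos (\<theta> - \<phi>) - m * \<theta>)" for \<theta> :: real
  proof -
    have "(\<lambda>b. exp (u * cis \<theta>) * cis (- (m * \<theta>)) * ((v * cis (- \<theta>)) ^ b /\<^sub>R fact b)) sums
        (exp (u * cis \<theta>) * cis (- (m * \<theta>)) * exp (v * cis (- \<theta>)))"
      by (intro sums_mult exp_converges)
    moreover have "exp (u * cis \<theta>) * cis (- (m * \<theta>)) * ((v * cis (- \<theta>)) ^ b /\<^sub>R fact b) = g b \<theta>" for b
    proof -
      have "cis (- \<theta>) ^ b * cis (- (m * \<theta>)) = cis (- (real_of_int (int b + m) * \<theta>))"
        by (simp only: Complex.DeMoivre cis_mult) (simp add: algebra_simps)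
      then show ?thesis
        by (simp add: g_def scaleR_conv_of_real power_mult_distrib divide_inverse mult_ac)
    qed
    moreover have "exp (u * cis \<theta>) * cis (- (m * \<theta>)) * exp (v * cis (- \<theta>)) = cis (x * cos (\<theta> - \<phi>) - m * \<theta>)"
      using gen[of \<theta>] cis_mult[of "x * cos (\<theta> - \<phi>)" "- (m * \<theta>)"] by (simp add: mult_ac)
    ultimately show ?thesis
      by (simp add: sums_iff)
  qed
  have "(\<lambda>b. integral {0..2*pi} (g b)) sums integral {0..2*pi} (\<lambda>\<theta>. \<Sum>b. g b \<theta>)"
  proof (rule integral_suminf_sums[where M = "\<lambda>b. norm v ^ b / fact b * exp (norm u)"])
    show "continuous_on {0..2*pi} (g b)" for b
      unfolding g_def by (intro continuous_intros)
    have "norm (exp (u * cis \<theta>)) \<le> exp (norm u)" for \<theta> :: real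
      using norm_exp[of "u * cis \<theta>"] by (simp add: norm_mult)
    then show "norm (g b \<theta>) \<le> norm v ^ b / fact b * exp (norm u)" for b \<theta>
      by (simp add: g_def norm_mult norm_divide norm_power divide_right_mono mult_left_mono)
    show "summable (\<lambda>b. norm v ^ b / fact b * exp (norm u))"
      using summable_exp_generic[of "norm v"]
      by (intro summable_mult2) (simp add: divide_inverse mult_ac)
  qed
  then have "(\<lambda>b. integral {0..2*pi} (g b)) sums ?I"
    unfolding * .
  then have s: "(\<lambda>b. v ^ b / fact b * (2 * pi * of_real (rGamma (real_of_int (int b + m + 1))) * u powi (int b + m)))
      sums ?I"
    unfolding g_def integral_mult_right integral_exp_cis .
  define t where "t = (\<lambda>k. (-1) ^ k / fact k * rGamma (real_of_int (int k + m + 1)) * (x / 2) powi (2 * int k + m))"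
  define c where "c = 2 * pi * \<i> powi m * cis (- (m * \<phi>))"
  have c0: "c \<noteq> 0"
    by (simp add: c_def)
  have term_eq: "v ^ b / fact b * (2 * pi * of_real (rGamma (real_of_int (int b + m + 1))) * u powi (int b + m))
      = c * of_real (t b)" for b
  proof (cases "int b + m \<ge> 0")
    case False
    then have "rGamma (real_of_int (int b + m + 1)) = 0"
      unfolding rGamma_eq_zero_iff by (intro nonpos_Ints_of_int) auto
    then show ?thesis
      by (simp add: t_def)
  next
    case True
    then obtain j where j: "int b + m = int j"
      using nonneg_int_cases by blast
    have "v ^ b * u ^ j = \<i> ^ (b + j) * of_real ((x / 2) ^ (b + j)) * (cis \<phi> ^ b * cis (- \<phi>) ^ j)"
      by (simp only: u_def v_def of_real_power of_real_mult power_mult_distrib power_add mult_ac)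
    also have "\<i> ^ (b + j) = \<i> powi m * (-1) ^ b"
    proof -
      have "\<i> powi int (b + j) = \<i> powi (m + 2 * int b)"
        using j by (intro arg_cong[where f = "\<lambda>k. \<i> powi k"]) auto
      also have "\<dots> = \<i> powi m * (\<i> powi 2) ^ b"
        by (simp add: power_int_add power_int_mult power_int_power')
      also have "\<i> powi 2 = -1"
        by (simp add: power_int_def)
      finally show ?thesis
        by (simp only: power_int_of_nat)
    qed
    also have "cis \<phi> ^ b * cis (- \<phi>) ^ j = cis (- (m * \<phi>))"
    proof -
      have "real j = real b + real_of_int m"
        using j by linarith
      then show ?thesis
        by (simp add: Complex.DeMoivre cis_mult algebra_simps)
    qed
    also have "(x / 2) ^ (b + j) = (x / 2) powi (2 * int b + m)"
    proof -
      have "2 * int b + m = int (b + j)" using j by auto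
      then show ?thesis by (simp only: power_int_of_nat)
    qed
    finally have "v ^ b * u powi (int b + m) = \<i> powi m * (-1) ^ b * of_real ((x / 2) powi (2 * int b + m)) * cis (- (m * \<phi>))"
      using j by (simp add: power_int_of_nat)
    then have "v ^ b * u powi (int b + m) * (2 * pi * of_real (rGamma (real_of_int (int b + m + 1))) / fact b)
        = \<i> powi m * (-1) ^ b * of_real ((x / 2) powi (2 * int b + m)) * cis (- (m * \<phi>)) * 
          (2 * pi * of_real (rGamma (real_of_int (int b + m + 1))) / fact b)"
      by (rule arg_cong)
    then show ?thesis
      by (simp add: t_def c_def mult_ac)
  qed
  have "(\<lambda>b. of_real (t b)) sums (?I / c)"
    using sums_divide[OF s[unfolded term_eq], of c] c0 by simp
  \<comment> \<open>Convergence of the real series, needed before \<open>suminf\<close> means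
    anything, is inherited from the complex sum just obtained.\<close>
  moreover from this have "(\<lambda>b. complex_of_real (t b)) sums of_real (suminf t)"
    by (metis sums_iff summable_of_real_iff suminf_of_real)
  ultimately have "?I / c = of_real (suminf t)"
    by (rule sums_unique2)
  then show ?thesis
    using c0 by (simp add: field_simps c_def t_def bessel_J_def)
qed

lemma bessel_J_integral0:
  "integral {0..2*pi} (\<lambda>\<theta>. cis (x * cos \<theta> - real_of_int m * \<theta>)) = 2 * pi * \<i> powi m * of_real (bessel_J m x)"
  using bessel_J_integral[of x 0 m] by simp

text \<open>The integrand of the integral representation has modulus 1. This crude bound controls
  both the radial integral and the decay of the weights.\<close>

lemma abs_bessel_J_le: "\<bar>bessel_J m x\<bar> \<le> 1"
proof -
  have "norm (integral {0..2*pi} (\<lambda>\<theta>. cis (x * cos \<theta> - real_of_int m * \<theta>))) \<le> 1 * (2 * pi - 0)"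
    by (intro integral_bound) (auto intro!: continuous_intros)
  then show ?thesis
    unfolding bessel_J_integral0 by (simp add: norm_mult norm_power_int)
qed

lemma bessel_J_0_0: "bessel_J 0 0 = 1"
  using bessel_J_integral0[of 0 0] by (simp add: scaleR_conv_of_real)

section \<open>Derivative and ladder relations\<close>

lemma bessel_J_has_derivative:
  "(bessel_J m has_real_derivative (bessel_J (m - 1) x - bessel_J (m + 1) x) / 2) (at x)"
proof -
  define e where "e = (\<lambda>m x \<theta>. cis (x * cos \<theta> - real_of_int m * \<theta>))"
  define c where "c = 2 * pi * \<i> powi m"
  have c0: "c \<noteq> 0"
    by (simp add: c_def)
  have cont: "continuous_on {0..2*pi} (e m x)" for m x
    unfolding e_def by (intro continuous_intros)
  have "((\<lambda>x. integral (cbox 0 (2*pi)) (e m x)) has_vector_derivative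
      integral (cbox 0 (2*pi)) (\<lambda>\<theta>. \<i> * of_real (cos \<theta>) * e m x \<theta>)) (at x within UNIV)"
  proof (rule leibniz_rule_vector_derivative)
    show "((\<lambda>x. e m x \<theta>) has_vector_derivative \<i> * of_real (cos \<theta>) * e m x \<theta>) (at x within UNIV)" for x \<theta>
      unfolding e_def by (auto intro!: derivative_eq_intros)
    show "e m x integrable_on cbox 0 (2*pi)" for x
      using cont by (auto intro: integrable_continuous_real)
    show "continuous_on (UNIV \<times> cbox 0 (2 * pi)) (\<lambda>(x, t). \<i> * complex_of_real (cos t) * e m x t)"
      unfolding e_def split_beta by (intro continuous_intros)
  qed auto
  moreover have "integral {0..2*pi} (\<lambda>\<theta>. \<i> * of_real (cos \<theta>) * e m x \<theta>)
      = c * of_real ((bessel_J (m - 1) x - bessel_J (m + 1) x) / 2)"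
  proof -
    \<comment> \<open>Multiplication by the cosine averages the two neighbouring orders. The powers
      of \<open>\<i>\<close> belonging to these orders absorb the factor \<open>\<i>\<close> with
      opposite signs, whence a difference and not a sum.\<close>
    have "\<i> * of_real (cos \<theta>) * e m x \<theta> = \<i> / 2 * (e (m - 1) x \<theta> + e (m + 1) x \<theta>)" for \<theta>
    proof -
      have "e (m - 1) x \<theta> = e m x \<theta> * cis \<theta>" "e (m + 1) x \<theta> = e m x \<theta> * cis (- \<theta>)"
        unfolding e_def cis_mult by (simp_all add: algebra_simps)
      moreover have c: "complex_of_real (cos \<theta>) = (cis \<theta> + cis (- \<theta>)) / 2"
        by (simp add: complex_eq_iff)
      ultimately show ?thesis
        unfolding c by (simp add: field_simps)
    qed
    then have "integral {0..2*pi} (\<lambda>\<theta>. \<i> * of_real (cos \<theta>) * e m x \<theta>)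
        = \<i> / 2 * (integral {0..2*pi} (e (m - 1) x) + integral {0..2*pi} (e (m + 1) x))"
      by (simp only: integral_mult_right integral_add[OF integrable_continuous_real[OF cont] integrable_continuous_real[OF cont]])
    also have "\<dots> = c * of_real ((bessel_J (m - 1) x - bessel_J (m + 1) x) / 2)"
      unfolding e_def bessel_J_integral0 c_def
      by (simp add: power_int_add power_int_diff field_simps)
    finally show ?thesis .
  qed
  moreover have "integral {0..2*pi} (e m x) = c * of_real (bessel_J m x)" for x
    unfolding e_def bessel_J_integral0 c_def ..
  ultimately have "((\<lambda>x. c * of_real (bessel_J m x)) has_vector_derivative
      c * of_real ((bessel_J (m - 1) x - bessel_J (m + 1) x) / 2)) (at x)"
    by (simp add: cbox_interval)
  then have "((\<lambda>x. inverse c * (c * of_real (bessel_J m x))) has_vector_derivative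
      inverse c * (c * of_real ((bessel_J (m - 1) x - bessel_J (m + 1) x) / 2))) (at x)"
    by (rule has_vector_derivative_mult_right)
  then have "((\<lambda>x. complex_of_real (bessel_J m x)) has_vector_derivative
      complex_of_real ((bessel_J (m - 1) x - bessel_J (m + 1) x) / 2)) (at x)"
    using c0 by (simp add: mult.assoc[symmetric])
  then show ?thesis
    unfolding has_vector_derivative_complex_iff by simp
qed

text \<open>Integrate the derivative of the \<open>2 * pi\<close>-periodic integrand of the integral representation.\<close>
lemma bessel_J_recurrence: "2 * of_int m * bessel_J m x = x * (bessel_J (m - 1) x + bessel_J (m + 1) x)"
proof -
  define e where "e = (\<lambda>m \<theta>. cis (x * cos \<theta> - real_of_int m * \<theta>))"
  define c where "c = 2 * pi * \<i> powi m"
  have c0: "c \<noteq> 0"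
    by (simp add: c_def)
  have cont: "continuous_on {0..2*pi} (e m)" for m
    unfolding e_def by (intro continuous_intros)
  have "((\<lambda>\<theta>. \<i> * of_real (- (x * sin \<theta>) - m) * e m \<theta>) has_integral e m (2 * pi) - e m 0) {0..2*pi}"
    unfolding e_def
    by (intro fundamental_theorem_of_calculus) (auto intro!: derivative_eq_intros)
  moreover have "e m (2 * pi) = e m 0"
  proof -
    have "cis (real_of_int m * (2 * pi)) = 1"
      using cis_multiple_2pi[of "of_int m"] by (simp add: mult_ac)
    then have "cis (x - real_of_int m * (2 * pi)) = cis x"
      by (metis cis_divide div_by_1)
    then show ?thesis
      by (simp add: e_def)
  qed
  moreover have "\<i> * of_real (- (x * sin \<theta>) - m) * e m \<theta>
      = (- of_real x / 2) * (e (m - 1) \<theta> - e (m + 1) \<theta>) - \<i> * of_int m * e m \<theta>" for \<theta>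
  proof -
    have "e (m - 1) \<theta> = e m \<theta> * cis \<theta>" "e (m + 1) \<theta> = e m \<theta> * cis (- \<theta>)"
      unfolding e_def cis_mult by (simp_all add: algebra_simps)
    moreover have "\<i> * of_real (sin \<theta>) = (cis \<theta> - cis (- \<theta>)) / 2"
      by (simp add: complex_eq_iff)
    then have "(- of_real x) * (\<i> * of_real (sin \<theta>)) * e m \<theta>
        = (- of_real x) * ((cis \<theta> - cis (- \<theta>)) / 2) * e m \<theta>"
      by (rule arg_cong)
    ultimately show ?thesis
      by (simp add: algebra_simps)
  qed
  ultimately have "((\<lambda>\<theta>. (- of_real x / 2) * (e (m - 1) \<theta> - e (m + 1) \<theta>) - \<i> * of_int m * e m \<theta>)
      has_integral 0) {0..2*pi}"
    by simp
  moreover have I: "(e m has_integral integral {0..2*pi} (e m)) {0..2*pi}" for m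
    by (intro integrable_integral integrable_continuous_real cont)
  have "((\<lambda>\<theta>. (- of_real x / 2) * (e (m - 1) \<theta> - e (m + 1) \<theta>) - (\<i> * of_int m) * e m \<theta>)
      has_integral (- of_real x / 2) * (integral {0..2*pi} (e (m - 1)) - integral {0..2*pi} (e (m + 1)))
        - (\<i> * of_int m) * integral {0..2*pi} (e m)) {0..2*pi}"
    by (intro has_integral_diff has_integral_mult_right I)
  ultimately have "(- of_real x / 2) * (integral {0..2*pi} (e (m - 1)) - integral {0..2*pi} (e (m + 1)))
      - (\<i> * of_int m) * integral {0..2*pi} (e m) = 0"
    by (simp only: has_integral_unique)
  then have "c * \<i> * of_real (x * (bessel_J (m - 1) x + bessel_J (m + 1) x) - 2 * of_int m * bessel_J m x) = 0"
    unfolding e_def bessel_J_integral0 c_def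
    by (simp add: power_int_add power_int_diff field_simps)
  then show ?thesis
    using c0 by (simp del: of_real_diff of_real_mult)
qed

text \<open>The derivative keeps its difference form and carries a factor \<open>x\<close>: the
  identity then holds at 0 as well and eliminates derivatives by rewriting, without
  division.\<close>

lemma bessel_J_deriv_down:
  "x * ((bessel_J (m - 1) x - bessel_J (m + 1) x) / 2) = of_int m * bessel_J m x - x * bessel_J (m + 1) x"
  using bessel_J_recurrence[of m x] by (simp add: field_simps)

lemma bessel_J_deriv_up:
  "x * ((bessel_J (m - 1) x - bessel_J (m + 1) x) / 2) = x * bessel_J (m - 1) x - of_int m * bessel_J m x"
  using bessel_J_recurrence[of m x] by (simp add: field_simps)

lemma continuous_on_bessel_J [continuous_intros]:
  assumes "continuous_on S g"
  shows "continuous_on S (\<lambda>x. bessel_J m (g x))"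
proof -
  have "continuous_on UNIV (bessel_J m)"
    by (meson DERIV_isCont bessel_J_has_derivative continuous_at_imp_continuous_on)
  from continuous_on_compose2[OF this assms] show ?thesis by simp
qed

lemma bessel_J_compose_has_derivative [derivative_intros]:
  assumes "(g has_real_derivative g') (at x within S)"
  shows "((\<lambda>x. bessel_J m (g x)) has_real_derivative
      (bessel_J (m - 1) (g x) - bessel_J (m + 1) (g x)) / 2 * g') (at x within S)"
  using DERIV_chain2[OF bessel_J_has_derivative assms] .

section \<open>Zeros of the Bessel functions\<close>

text \<open>One \<open>\<epsilon>\<close> serves all orders. Positivity of \<open>bessel_J 0\<close>
  on an initial interval passes to order \<open>p\<close> on the same interval, since
  \<open>x ^ p\<close> times the function of order \<open>p\<close> vanishes at 0 and has derivative
  \<open>x ^ p\<close> times the function of order \<open>p - 1\<close>. For order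
  \<open>- p\<close> each step changes the sign, which \<open>bessel_sign\<close> records.\<close>

lemma bessel_J_sign_near_0:
  obtains \<epsilon> where "\<epsilon> > 0" "\<And>m x. 0 < x \<Longrightarrow> x < \<epsilon> \<Longrightarrow> bessel_sign m * bessel_J m x > 0"
proof -
  have "isCont (bessel_J 0) 0"
    using bessel_J_has_derivative DERIV_isCont by blast
  then have "\<forall>\<^sub>F x in at 0. bessel_J 0 x > 0"
    unfolding isCont_def using bessel_J_0_0 by (intro order_tendstoD) auto
  then obtain \<epsilon> where \<epsilon>: "\<epsilon> > 0" and pos0: "\<And>x. 0 < x \<Longrightarrow> x < \<epsilon> \<Longrightarrow> bessel_J 0 x > 0"
    unfolding eventually_at by (auto simp: dist_real_def)
  have up: "0 < x \<Longrightarrow> x < \<epsilon> \<Longrightarrow> bessel_J (int p) x > 0" for p x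
  proof (induction p arbitrary: x)
    case (Suc p)
    have "0 ^ Suc p * bessel_J (int (Suc p)) 0 < x ^ Suc p * bessel_J (int (Suc p)) x"
    proof (rule DERIV_pos_imp_increasing_open[OF \<open>0 < x\<close>])
      fix y assume y: "0 < y" "y < x"
      have "((\<lambda>y. y ^ Suc p * bessel_J (int (Suc p)) y) has_real_derivative
          y ^ p * (real (Suc p) * bessel_J (int (Suc p)) y
            + y * ((bessel_J (int (Suc p) - 1) y - bessel_J (int (Suc p) + 1) y) / 2))) (at y)"
        by (rule DERIV_cong[OF DERIV_mult[OF DERIV_pow bessel_J_has_derivative]]) (simp add: algebra_simps)
      then have "((\<lambda>y. y ^ Suc p * bessel_J (int (Suc p)) y) has_real_derivative
          y ^ p * (y * bessel_J (int p) y)) (at y)"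
        unfolding bessel_J_deriv_up by simp
      moreover have "0 < y ^ p * (y * bessel_J (int p) y)"
        using Suc.IH[of y] y Suc.prems by simp
      ultimately show "\<exists>D. ((\<lambda>y. y ^ Suc p * bessel_J (int (Suc p)) y) has_real_derivative D) (at y) \<and> 0 < D"
        by blast
    qed (intro continuous_intros)
    then have "0 < x ^ Suc p * bessel_J (int (Suc p)) x"
      by simp
    moreover have "0 < x ^ Suc p"
      using Suc.prems by simp
    ultimately show ?case
      by (rule zero_less_mult_pos)
  qed (use pos0 in simp)
  have down: "0 < x \<Longrightarrow> x < \<epsilon> \<Longrightarrow> (-1) ^ p * bessel_J (- int p) x > 0" for p x
  proof (induction p arbitrary: x)
    case (Suc p)
    have "(-1) ^ Suc p * (0 ^ Suc p * bessel_J (- int (Suc p)) 0) < (-1) ^ Suc p * (x ^ Suc p * bessel_J (- int (Suc p)) x)"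
    proof (rule DERIV_pos_imp_increasing_open[OF \<open>0 < x\<close>])
      fix y assume y: "0 < y" "y < x"
      have "((\<lambda>y. (-1) ^ Suc p * (y ^ Suc p * bessel_J (- int (Suc p)) y)) has_real_derivative
          (-1) ^ Suc p * (y ^ p * (real (Suc p) * bessel_J (- int (Suc p)) y
            + y * ((bessel_J (- int (Suc p) - 1) y - bessel_J (- int (Suc p) + 1) y) / 2)))) (at y)"
        by (rule DERIV_cong[OF DERIV_cmult[OF DERIV_mult[OF DERIV_pow bessel_J_has_derivative]]])
           (simp add: algebra_simps)
      then have "((\<lambda>y. (-1) ^ Suc p * (y ^ Suc p * bessel_J (- int (Suc p)) y)) has_real_derivative
          y ^ p * (y * ((-1) ^ p * bessel_J (- int p) y))) (at y)"
        unfolding bessel_J_deriv_down by (simp add: algebra_simps)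
      moreover have "0 < y ^ p * (y * ((-1) ^ p * bessel_J (- int p) y))"
        using Suc.IH[of y] y Suc.prems by simp
      ultimately show "\<exists>D. ((\<lambda>y. (-1) ^ Suc p * (y ^ Suc p * bessel_J (- int (Suc p)) y)) has_real_derivative D) (at y) \<and> 0 < D"
        by blast
    qed (intro continuous_intros)
    then have "0 < x ^ Suc p * ((-1) ^ Suc p * bessel_J (- int (Suc p)) x)"
      by (simp add: mult.left_commute)
    moreover have "0 < x ^ Suc p"
      using Suc.prems by simp
    ultimately show ?case
      by (rule zero_less_mult_pos)
  qed (use pos0 in simp)
  have "bessel_sign m * bessel_J m x > 0" if "0 < x" "x < \<epsilon>" for m x
  proof (cases "m \<ge> 0")
    case True
    then show ?thesis
      using up[OF that, of "nat m"] by (simp add: bessel_sign_def)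
  next
    case False
    then show ?thesis
      using down[OF that, of "nat (- m)"] by (simp add: bessel_sign_def power_int_def)
  qed
  with \<epsilon> that show thesis
    by blast
qed

text \<open>Lommel's primitive of \<open>x * (bessel_J m x)\<^sup>2\<close>, with derivatives
  eliminated. It is 0 at the origin and reduces to
  \<open>x\<^sup>2 / 2 * (bessel_J (m + 1) x)\<^sup>2\<close> at a zero of
  \<open>bessel_J m\<close>; so it yields both the simplicity of the zeros and the normalising
  integral.\<close>

definition bessel_energy :: "int \<Rightarrow> real \<Rightarrow> real" where
  "bessel_energy m x = x\<^sup>2 / 2 * ((bessel_J m x)\<^sup>2 + (bessel_J (m + 1) x)\<^sup>2)
     - of_int m * x * bessel_J m x * bessel_J (m + 1) x"

lemma bessel_energy_has_derivative:
  "(bessel_energy m has_real_derivative x * (bessel_J m x)\<^sup>2) (at x)"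
proof -
  define p q where "p = (bessel_J (m - 1) x - bessel_J (m + 1) x) / 2"
    and "q = (bessel_J m x - bessel_J (m + 2) x) / 2"
  define P Q \<mu> where "P = bessel_J m x" and "Q = bessel_J (m + 1) x" and "\<mu> = real_of_int m"
  have p: "x * p = \<mu> * P - x * Q"
    using bessel_J_deriv_down[of x m] by (simp add: p_def P_def Q_def \<mu>_def)
  have q: "x * q = x * P - (\<mu> + 1) * Q"
    using bessel_J_deriv_up[of x "m + 1"] by (simp add: q_def P_def Q_def \<mu>_def add.commute)
  have "(bessel_energy m has_real_derivative
      x * (P\<^sup>2 + Q\<^sup>2) + x * P * (x * p) + x * Q * (x * q) - \<mu> * P * Q - \<mu> * Q * (x * p) - \<mu> * P * (x * q)) (at x)"
    unfolding bessel_energy_def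
    by (auto intro!: derivative_eq_intros
        simp: p_def q_def P_def Q_def \<mu>_def power2_eq_square field_simps)
  also have "x * (P\<^sup>2 + Q\<^sup>2) + x * P * (x * p) + x * Q * (x * q) - \<mu> * P * Q - \<mu> * Q * (x * p) - \<mu> * P * (x * q) = x * P\<^sup>2"
    unfolding p q by (simp add: power2_eq_square algebra_simps)
  finally show ?thesis
    by (simp add: P_def)
qed

text \<open>The energy starts at 0 and never decreases. It increases strictly at first because
  \<open>bessel_J m\<close> has no zero close to the origin.\<close>

lemma bessel_energy_pos:
  assumes "0 < x"
  shows "0 < bessel_energy m x"
proof -
  obtain \<epsilon> where \<epsilon>: "\<epsilon> > 0" "\<And>m x. 0 < x \<Longrightarrow> x < \<epsilon> \<Longrightarrow> bessel_sign m * bessel_J m x > 0"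
    using bessel_J_sign_near_0 by blast
  define y where "y = min (\<epsilon> / 2) x"
  have y: "0 < y" "y < \<epsilon>" "y \<le> x"
    using \<epsilon>(1) assms by (auto simp: y_def)
  have "continuous_on S (bessel_energy m)" for S
    unfolding bessel_energy_def by (auto intro!: continuous_intros)
  then have "bessel_energy m 0 < bessel_energy m y"
  proof (intro DERIV_pos_imp_increasing_open[OF y(1)])
    fix t assume t: "0 < t" "t < y"
    then have "bessel_J m t \<noteq> 0"
      using \<epsilon>(2)[of t m] y(2) by auto
    then show "\<exists>D. (bessel_energy m has_real_derivative D) (at t) \<and> 0 < D"
      using t by (intro exI[of _ "t * (bessel_J m t)\<^sup>2"] conjI bessel_energy_has_derivative) simp
  qed
  also have "bessel_energy m y \<le> bessel_energy m x"
  proof (rule DERIV_nonneg_imp_nondecreasing[OF y(3)])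
    fix t assume "y \<le> t" "t \<le> x"
    then show "\<exists>D. (bessel_energy m has_real_derivative D) (at t) \<and> 0 \<le> D"
      using y(1) by (intro exI[of _ "t * (bessel_J m t)\<^sup>2"] conjI bessel_energy_has_derivative) simp
  qed
  finally show ?thesis
    by (simp add: bessel_energy_def)
qed

text \<open>At a common positive zero of two consecutive orders the energy would vanish.\<close>

lemma bessel_J_zero_simple:
  assumes "0 < x" "bessel_J m x = 0"
  shows "bessel_J (m + 1) x \<noteq> 0"
  using bessel_energy_pos[OF assms(1), of m] assms(2) by (auto simp: bessel_energy_def)

lemma bessel_J_has_derivative_zero:
  assumes "0 < z" "bessel_J m z = 0"
  shows "(bessel_J m has_real_derivative - bessel_J (m + 1) z) (at z)"
proof -
  have "z * ((bessel_J (m - 1) z - bessel_J (m + 1) z) / 2) = z * (- bessel_J (m + 1) z)"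
    using bessel_J_deriv_down[of z m] assms(2) by simp
  then have "(bessel_J (m - 1) z - bessel_J (m + 1) z) / 2 = - bessel_J (m + 1) z"
    using assms(1) by (subst (asm) mult_left_cancel) auto
  then show ?thesis
    using bessel_J_has_derivative[of m z] by (simp only:)
qed

lemma bessel_J_sign_const:
  assumes "\<And>x. a \<le> x \<Longrightarrow> x \<le> b \<Longrightarrow> bessel_J m x \<noteq> 0" "a \<le> b" "s * bessel_J m a > 0"
  shows "s * bessel_J m b > 0"
proof (rule ccontr)
  assume "\<not> s * bessel_J m b > 0"
  then have "\<exists>x\<ge>a. x \<le> b \<and> s * bessel_J m x = 0"
    using assms by (intro IVT2' continuous_intros) auto
  then show False
    using assms by auto
qed

text \<open>
  Sturm comparison: \<open>u x = sqrt x * bessel_J m x\<close> satisfies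
  \<open>u'' = - (1 - (m\<^sup>2 - 1/4) / x\<^sup>2) * u\<close> and is compared with \<open>w x = sin ((x - a) / 2)\<close>.
  The function \<open>W\<close> is the Wronskian \<open>u' * w - u * w'\<close>.
\<close>
lemma bessel_J_zero_exists:
  assumes a: "a \<ge> 2 * \<bar>real_of_int m\<bar> + 1"
  shows "\<exists>z\<ge>a. bessel_J m z = 0"
proof (rule ccontr)
  assume "\<not> ?thesis"
  then have nz: "bessel_J m x \<noteq> 0" if "x \<ge> a" for x
    using that by auto
  define s where "s = sgn (bessel_J m a)"
  have "s * bessel_J m a > 0"
    using nz[of a] by (auto simp: s_def sgn_if)
  then have pos: "s * bessel_J m x > 0" if "x \<ge> a" for x
    using bessel_J_sign_const[of a x m s] nz that by auto
  define \<mu> where "\<mu> = real_of_int m"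
  \<comment> \<open>With \<open>bessel_J m\<close> differentiated by the ladder relation,
    \<open>num\<close> is \<open>sqrt x\<close> times the Wronskian, so a single quotient remains to
    be differentiated.\<close>
  define num where "num = (\<lambda>x. ((\<mu> + 1/2) * bessel_J m x - x * bessel_J (m + 1) x) * sin ((x - a) / 2)
    - x * bessel_J m x * cos ((x - a) / 2) / 2)"
  define W where "W = (\<lambda>x. s * (num x / sqrt x))"
  \<comment> \<open>The interval is one arch of the comparison sine. For
    \<open>x \<ge> 2 * \<bar>m\<bar>\<close> the coefficient in the equation of \<open>u\<close>
    exceeds the \<open>1/4\<close> belonging to \<open>w\<close>, so \<open>W\<close> decreases; but
    where \<open>w\<close> vanishes the sign of \<open>W\<close> comes from \<open>w'\<close>,
    negative at the left end and positive at the right. The \<open>+ 1\<close> in the hypothesis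
    keeps \<open>x\<close> positive for \<open>m = 0\<close>.\<close>
  have "W (a + 2 * pi) \<le> W a"
  proof (rule DERIV_nonpos_imp_nonincreasing[where f = W])
    fix x assume x: "a \<le> x" "x \<le> a + 2 * pi"
    have x0: "x > 0"
      using a x by linarith
    define p q where "p = (bessel_J (m - 1) x - bessel_J (m + 1) x) / 2"
      and "q = (bessel_J m x - bessel_J (m + 2) x) / 2"
    define P Q where "P = bessel_J m x" and "Q = bessel_J (m + 1) x"
    define S C where "S = sin ((x - a) / 2)" and "C = cos ((x - a) / 2)"
    have p: "x * p = \<mu> * P - x * Q"
      using bessel_J_deriv_down[of x m] by (simp add: p_def P_def Q_def \<mu>_def)
    have q: "x * q = x * P - (\<mu> + 1) * Q"
      using bessel_J_deriv_up[of x "m + 1"] by (simp add: q_def P_def Q_def \<mu>_def add.commute)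
    have num: "num x = ((\<mu> + 1/2) * P - x * Q) * S - x * P * C / 2"
      by (simp add: num_def P_def Q_def S_def C_def)
    define N' where "N' = ((\<mu> + 1/2) * p - Q - x * q) * S + ((\<mu> + 1/2) * P - x * Q) * C / 2
      - (P + x * p) * C / 2 + x * P * S / 4"
    have "(num has_real_derivative N') (at x)"
      unfolding num_def
      by (auto intro!: derivative_eq_intros
          simp: p_def q_def P_def Q_def S_def C_def N'_def field_simps)
    then have "(W has_real_derivative s * ((N' * sqrt x - num x * (inverse (sqrt x) / 2)) / (sqrt x * sqrt x))) (at x)"
      unfolding W_def using x0 by (intro DERIV_cmult DERIV_divide DERIV_real_sqrt) auto
    moreover have e1: "N' * sqrt x - num x * (inverse (sqrt x) / 2) = (x * N' - num x / 2) / sqrt x"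
      using x0 by (simp add: field_simps)
    moreover have e2: "x * N' - num x / 2 = (\<mu>\<^sup>2 - 1/4 - 3/4 * x\<^sup>2) * (P * S)"
    proof -
      have "x * N' = ((\<mu> + 1/2) * (x * p) - x * Q - x * (x * q)) * S + x * ((\<mu> + 1/2) * P - x * Q) * C / 2
          - (x * P + x * (x * p)) * C / 2 + x\<^sup>2 * P * S / 4"
        by (simp add: N'_def algebra_simps power2_eq_square)
      then show ?thesis
        unfolding p q num by (simp add: field_simps power2_eq_square)
    qed
    moreover have e3: "s * (((\<mu>\<^sup>2 - 1/4 - 3/4 * x\<^sup>2) * (P * S)) / sqrt x / (sqrt x * sqrt x))
        = (\<mu>\<^sup>2 - 1/4 - 3/4 * x\<^sup>2) * (s * P) * S / (sqrt x * (sqrt x * sqrt x))"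
      by (simp only: divide_inverse inverse_mult_distrib mult_ac)
    ultimately have "(W has_real_derivative
        (\<mu>\<^sup>2 - 1/4 - 3/4 * x\<^sup>2) * (s * P) * S / (sqrt x * (sqrt x * sqrt x))) (at x)"
      by (simp only: e1 e2 e3)
    moreover have "(\<mu>\<^sup>2 - 1/4 - 3/4 * x\<^sup>2) * (s * P) * S / (sqrt x * (sqrt x * sqrt x)) \<le> 0"
    proof -
      have "(2 * \<bar>\<mu>\<bar>)\<^sup>2 \<le> x\<^sup>2"
        using a x by (intro power_mono) (auto simp: \<mu>_def)
      then have "4 * \<mu>\<^sup>2 \<le> x\<^sup>2"
        by (simp add: power_mult_distrib)
      then have "\<mu>\<^sup>2 - 1/4 - 3/4 * x\<^sup>2 \<le> 0"
        using zero_le_power2[of x] by linarith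
      moreover have "s * P \<ge> 0"
        using pos[of x] x by (simp add: P_def)
      moreover have "S \<ge> 0"
        unfolding S_def using x by (intro sin_ge_zero) auto
      ultimately show ?thesis
        using x0 by (intro divide_nonpos_nonneg mult_nonpos_nonneg) auto
    qed
    ultimately show "\<exists>D. (W has_real_derivative D) (at x) \<and> D \<le> 0"
      by blast
  qed simp
  moreover have "W a < 0"
    using pos[of a] a by (auto simp: W_def num_def divide_neg_pos zero_less_mult_iff mult_less_0_iff)
  moreover have "W (a + 2 * pi) > 0"
  proof -
    have "W (a + 2 * pi) = (a + 2 * pi) * (s * bessel_J m (a + 2 * pi)) / 2 / sqrt (a + 2 * pi)"
      by (simp add: W_def num_def mult_ac)
    moreover have "a + 2 * pi > 0"
      using a pi_gt_zero by linarith
    ultimately show ?thesis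
      using pos[of "a + 2 * pi"] by simp
  qed
  ultimately show False
    by linarith
qed

text \<open>Infinitely many zeros would accumulate at some \<open>p\<close>. It is positive, as
  there are no zeros near the origin, and by continuity it is a zero itself; but a simple zero is
  isolated.\<close>

lemma finite_bessel_J_zeros: "finite {x. 0 < x \<and> x \<le> b \<and> bessel_J m x = 0}" (is "finite ?Z")
proof (rule ccontr)
  assume inf: "infinite ?Z"
  obtain \<epsilon> where \<epsilon>: "\<epsilon> > 0" "\<And>m x. 0 < x \<Longrightarrow> x < \<epsilon> \<Longrightarrow> bessel_sign m * bessel_J m x > 0"
    using bessel_J_sign_near_0 by blast
  have sub: "?Z \<subseteq> {\<epsilon>..b}"
    using \<epsilon>(2)[of _ m] by force
  then have "bounded ?Z"
    using bounded_closed_interval bounded_subset by blast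
  then obtain p where p: "p islimpt ?Z"
    using bounded_infinite_imp_islimpt[OF subset_refl _ inf] by blast
  have "closed ({\<epsilon>..b} \<inter> {x. bessel_J m x = 0})"
    by (intro closed_Int closed_Collect_eq continuous_intros closed_atLeastAtMost)
  moreover have "p islimpt ({\<epsilon>..b} \<inter> {x. bessel_J m x = 0})"
    by (rule islimpt_subset[OF p]) (use sub in auto)
  ultimately have "p \<in> {\<epsilon>..b} \<inter> {x. bessel_J m x = 0}"
    unfolding closed_limpt by blast
  then have p0: "p > 0" "bessel_J m p = 0"
    using \<epsilon>(1) by auto
  have "((\<lambda>x. (bessel_J m x - bessel_J m p) / (x - p)) \<longlongrightarrow> - bessel_J (m + 1) p) (at p)"
    using bessel_J_has_derivative_zero[OF p0] by (simp add: has_field_derivative_iff)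
  then have "\<forall>\<^sub>F x in at p. (bessel_J m x - bessel_J m p) / (x - p) \<noteq> 0"
    by (rule tendsto_imp_eventually_ne) (use bessel_J_zero_simple[OF p0] in simp)
  then have "\<forall>\<^sub>F x in at p. x \<notin> ?Z"
    by eventually_elim (use p0 in auto)
  then show False
    using p by (simp add: islimpt_iff_eventually)
qed

section \<open>Enumeration of the positive zeros and signs of the next order there\<close>

lemma bessel_J_zero_unique:
  assumes "0 < z" "bessel_J m z = 0" "0 < z'" "bessel_J m z' = 0"
    and "card {x. 0 < x \<and> x \<le> z \<and> bessel_J m x = 0} = card {x. 0 < x \<and> x \<le> z' \<and> bessel_J m x = 0}"
  shows "z = z'"
proof -
  have "card {x. 0 < x \<and> x \<le> u \<and> bessel_J m x = 0} < card {x. 0 < x \<and> x \<le> v \<and> bessel_J m x = 0}"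
    if "0 < v" "bessel_J m v = 0" "u < v" for u v
  proof (intro psubset_card_mono finite_bessel_J_zeros psubsetI subsetI)
    show "{x. 0 < x \<and> x \<le> u \<and> bessel_J m x = 0} \<noteq> {x. 0 < x \<and> x \<le> v \<and> bessel_J m x = 0}"
      using that by (metis (mono_tags, lifting) mem_Collect_eq not_le order_refl)
  qed (use that in simp)
  from this[of z z'] this[of z' z] show ?thesis
    using assms by linarith
qed

text \<open>The sign just after the \<open>n\<close>-th zero is carried along to make the induction
  work: it persists up to the next zero and so determines the slope there, which is
  \<open>- bessel_J (m + 1)\<close>. The induction starts from \<open>z = 0\<close>, which is not
  counted as a zero; hence the guard \<open>n > 0\<close>.\<close>

lemma bessel_J_nth_zero:
  "\<exists>z\<ge>0. card {x. 0 < x \<and> x \<le> z \<and> bessel_J m x = 0} = n \<and>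
     (n > 0 \<longrightarrow> 0 < z \<and> bessel_J m z = 0 \<and> bessel_sign m * (-1) ^ n * bessel_J (m + 1) z < 0) \<and>
     (\<exists>\<delta>>0. \<forall>x. z < x \<and> x < z + \<delta> \<longrightarrow> bessel_sign m * (-1) ^ n * bessel_J m x > 0)"
proof (induction n)
  case 0
  obtain \<epsilon> where \<epsilon>: "\<epsilon> > 0" "\<And>m x. 0 < x \<Longrightarrow> x < \<epsilon> \<Longrightarrow> bessel_sign m * bessel_J m x > 0"
    using bessel_J_sign_near_0 by blast
  have "{x. 0 < x \<and> x \<le> 0 \<and> bessel_J m x = 0} = {}"
    by auto
  then have "card {x. 0 < x \<and> x \<le> 0 \<and> bessel_J m x = 0} = 0"
    by (simp only: card.empty)
  then show ?case
    using \<epsilon> by (intro exI[of _ 0]) auto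
next
  case (Suc n)
  define s where "s = bessel_sign m * (-1) ^ n"
  obtain z \<delta> where z: "z \<ge> 0" "card {x. 0 < x \<and> x \<le> z \<and> bessel_J m x = 0} = n"
    and \<delta>: "\<delta> > 0" "\<And>x. z < x \<Longrightarrow> x < z + \<delta> \<Longrightarrow> s * bessel_J m x > 0"
    using Suc.IH unfolding s_def by blast
  \<comment> \<open>The zero \<open>w\<close> need not be the next one; it only makes the set in
    which the next zero is the minimum nonempty. The \<open>max\<close> reaches the threshold of
    \<open>bessel_J_zero_exists\<close>.\<close>
  obtain w where w: "w \<ge> z + 1" "bessel_J m w = 0"
    using bessel_J_zero_exists[of m "max (z + 1) (2 * \<bar>real_of_int m\<bar> + 1)"] by auto
  define A where "A = {x. z < x \<and> x \<le> w \<and> bessel_J m x = 0}"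
  have "finite A"
    using z(1) by (rule_tac finite_subset[OF _ finite_bessel_J_zeros[of w m]]) (auto simp: A_def)
  moreover have "w \<in> A"
    using w by (auto simp: A_def)
  moreover define z' where "z' = Min A"
  ultimately have "z' \<in> A" and z'_le: "\<And>x. x \<in> A \<Longrightarrow> z' \<le> x"
    using Min_in[of A] Min_le[of A] by blast+
  then have z': "z < z'" "bessel_J m z' = 0" "z' \<le> w" "0 < z'"
    using z(1) by (auto simp: A_def)
  have nz: "bessel_J m x \<noteq> 0" if "z < x" "x < z'" for x
  proof
    assume "bessel_J m x = 0"
    then have "x \<in> A"
      using that z' by (simp add: A_def)
    then show False
      using z'_le that by fastforce
  qed
  have pos: "s * bessel_J m x > 0" if "z < x" "x < z'" for x
  proof -
    define y where "y = min x (z + \<delta> / 2)"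
    have y: "z < y" "y < z + \<delta>" "y \<le> x"
      using that \<delta>(1) by (auto simp: y_def min_def)
    then show ?thesis
      using bessel_J_sign_const[of y x m s] nz \<delta>(2)[of y] that by auto
  qed
  have d: "((\<lambda>x. s * bessel_J m x) has_real_derivative s * (- bessel_J (m + 1) z')) (at z')"
    by (intro DERIV_cmult bessel_J_has_derivative_zero z')
  have s0: "s \<noteq> 0"
    by (auto simp: s_def bessel_sign_def)
  \<comment> \<open>The slope is nonzero by simplicity. A positive slope would make
    \<open>s * bessel_J m\<close> negative just to the left of \<open>z'\<close>, where it is
    positive.\<close>
  have neg: "s * (- bessel_J (m + 1) z') < 0"
  proof (rule ccontr)
    assume "\<not> ?thesis"
    then have "s * (- bessel_J (m + 1) z') > 0"
      using s0 bessel_J_zero_simple[OF z'(4,2)] by (auto simp: not_less order_le_less)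
    then obtain e where e: "e > 0" "\<And>h. 0 < h \<Longrightarrow> h < e \<Longrightarrow> s * bessel_J m (z' - h) < s * bessel_J m z'"
      using DERIV_pos_inc_left[OF d] by blast
    define h where "h = min (e / 2) ((z' - z) / 2)"
    have "0 < h" "h < e" "z < z' - h"
      using e(1) z'(1) by (auto simp: h_def min_def field_simps)
    then show False
      using e(2)[of h] pos[of "z' - h"] z'(2) by simp
  qed
  then obtain e where e: "e > 0" "\<And>h. 0 < h \<Longrightarrow> h < e \<Longrightarrow> s * bessel_J m z' > s * bessel_J m (z' + h)"
    using DERIV_neg_dec_right[OF d] by blast
  have "0 < x \<and> x \<le> z' \<and> bessel_J m x = 0 \<longleftrightarrow> x = z' \<or> 0 < x \<and> x \<le> z \<and> bessel_J m x = 0" for x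
    using nz[of x] z' z(1) by (cases "x \<le> z"; cases "x < z'") auto
  then have "{x. 0 < x \<and> x \<le> z' \<and> bessel_J m x = 0} = insert z' {x. 0 < x \<and> x \<le> z \<and> bessel_J m x = 0}"
    by blast
  then have "card {x. 0 < x \<and> x \<le> z' \<and> bessel_J m x = 0} = Suc n"
    using z' z(2) finite_bessel_J_zeros[of z m] by simp
  moreover have "bessel_sign m * (-1) ^ Suc n * bessel_J m x > 0" if "z' < x" "x < z' + e" for x
    using e(2)[of "x - z'"] that z'(2) by (simp add: s_def)
  ultimately show ?case
    using z' neg e(1) by (intro exI[of _ z']) (auto simp: s_def)
qed

lemma bessel_zero:
  assumes "n \<ge> 1"
  shows bessel_zero_pos: "0 < bessel_zero m n"
    and bessel_J_bessel_zero: "bessel_J m (bessel_zero m n) = 0"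
    and bessel_J_Suc_bessel_zero:
      "bessel_sign m * (-1) ^ n * bessel_J (m + 1) (bessel_zero m n) < 0"
proof -
  obtain z where z: "0 < z" "bessel_J m z = 0"
    "card {x. 0 < x \<and> x \<le> z \<and> bessel_J m x = 0} = n"
    "bessel_sign m * (-1) ^ n * bessel_J (m + 1) z < 0"
    using bessel_J_nth_zero[of m n] assms by auto
  have "bessel_zero m n = z"
    unfolding bessel_zero_def using z bessel_J_zero_unique by (intro the_equality) auto
  then show "0 < bessel_zero m n" "bessel_J m (bessel_zero m n) = 0"
    "bessel_sign m * (-1) ^ n * bessel_J (m + 1) (bessel_zero m n) < 0"
    using z by auto
qed

section \<open>Fourier-Bessel coefficients of characters\<close>

text \<open>\<open>G\<close> is a primitive of the integrand times
  \<open>a\<^sup>2 - b\<^sup>2\<close>: in its derivative all terms with the factor \<open>m\<close>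
  cancel. It vanishes at 0, and at 1 the condition on \<open>b\<close> leaves only the term with
  \<open>bessel_J m a\<close>.\<close>

lemma Lommel_integral:
  assumes "bessel_J m b = 0" "a\<^sup>2 \<noteq> b\<^sup>2"
  shows "((\<lambda>r. r * bessel_J m (a * r) * bessel_J m (b * r)) has_integral
    - b * bessel_J (m + 1) b * (bessel_J m a / (a\<^sup>2 - b\<^sup>2))) {0..1}"
proof -
  define G where "G = (\<lambda>r. r * (a * bessel_J (m + 1) (a * r) * bessel_J m (b * r)
    - b * bessel_J m (a * r) * bessel_J (m + 1) (b * r)))"
  have "(G has_real_derivative (a\<^sup>2 - b\<^sup>2) * (r * bessel_J m (a * r) * bessel_J m (b * r))) (at r)" for r
  proof -
    define P Q where "P = (\<lambda>c. bessel_J m (c * r))" and "Q = (\<lambda>c. bessel_J (m + 1) (c * r))"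
    define p q where "p = (\<lambda>c. (bessel_J (m - 1) (c * r) - bessel_J (m + 1) (c * r)) / 2)"
      and "q = (\<lambda>c. (bessel_J m (c * r) - bessel_J (m + 2) (c * r)) / 2)"
    define \<mu> where "\<mu> = real_of_int m"
    have p: "r * (c * p c) = \<mu> * P c - c * r * Q c" for c
      using bessel_J_deriv_down[of "c * r" m] by (simp add: p_def P_def Q_def \<mu>_def mult_ac)
    have q: "r * (c * q c) = c * r * P c - (\<mu> + 1) * Q c" for c
      using bessel_J_deriv_up[of "c * r" "m + 1"]
      by (simp add: q_def P_def Q_def \<mu>_def add.commute mult_ac)
    have "(G has_real_derivative a * Q a * P b - b * P a * Q b
        + (a * (r * (a * q a)) * P b + a * Q a * (r * (b * p b))
           - b * (r * (a * p a)) * Q b - b * P a * (r * (b * q b)))) (at r)"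
      unfolding G_def
      by (auto intro!: derivative_eq_intros simp: p_def q_def P_def Q_def field_simps)
    also have "a * Q a * P b - b * P a * Q b
        + (a * (r * (a * q a)) * P b + a * Q a * (r * (b * p b))
           - b * (r * (a * p a)) * Q b - b * P a * (r * (b * q b)))
        = (a\<^sup>2 - b\<^sup>2) * (r * P a * P b)"
      unfolding p q by (simp add: power2_eq_square algebra_simps)
    finally show ?thesis
      by (simp add: P_def)
  qed
  then have "((\<lambda>r. (a\<^sup>2 - b\<^sup>2) * (r * bessel_J m (a * r) * bessel_J m (b * r))) has_integral G 1 - G 0) {0..1}"
    by (intro fundamental_theorem_of_calculus)
       (auto simp: has_real_derivative_iff_has_vector_derivative[symmetric]
          intro: has_field_derivative_at_within)
  then have "((\<lambda>r. inverse (a\<^sup>2 - b\<^sup>2) * ((a\<^sup>2 - b\<^sup>2) * (r * bessel_J m (a * r) * bessel_J m (b * r))))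
      has_integral inverse (a\<^sup>2 - b\<^sup>2) * (G 1 - G 0)) {0..1}"
    by (rule has_integral_mult_right)
  moreover have "inverse (a\<^sup>2 - b\<^sup>2) * (G 1 - G 0) = - b * bessel_J (m + 1) b * (bessel_J m a / (a\<^sup>2 - b\<^sup>2))"
    using assms by (simp add: G_def divide_inverse)
  ultimately show ?thesis
    using assms(2) by (simp add: mult.assoc[symmetric])
qed

text \<open>For equal parameters the primitive is the rescaled energy.\<close>

lemma Lommel_integral_square:
  assumes "bessel_J m b = 0" "b \<noteq> 0"
  shows "((\<lambda>r. r * bessel_J m (b * r) * bessel_J m (b * r)) has_integral (bessel_J (m + 1) b)\<^sup>2 / 2) {0..1}"
proof -
  have "((\<lambda>r. bessel_energy m (b * r) / b\<^sup>2) has_real_derivative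
      b * r * (bessel_J m (b * r))\<^sup>2 * b / b\<^sup>2) (at r)" for r
    by (intro DERIV_cdivide DERIV_chain2[OF bessel_energy_has_derivative] DERIV_cmult_Id)
  moreover have "b * r * (bessel_J m (b * r))\<^sup>2 * b / b\<^sup>2 = r * bessel_J m (b * r) * bessel_J m (b * r)" for r
    using assms(2) by (simp add: power2_eq_square)
  ultimately have "((\<lambda>r. bessel_energy m (b * r) / b\<^sup>2) has_real_derivative
      r * bessel_J m (b * r) * bessel_J m (b * r)) (at r)" for r
    by (simp only:)
  then have "((\<lambda>r. r * bessel_J m (b * r) * bessel_J m (b * r)) has_integral
      bessel_energy m (b * 1) / b\<^sup>2 - bessel_energy m (b * 0) / b\<^sup>2) {0..1}"
    by (intro fundamental_theorem_of_calculus)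
       (auto simp: has_real_derivative_iff_has_vector_derivative[symmetric]
          intro: has_field_derivative_at_within)
  then show ?thesis
    using assms by (simp add: bessel_energy_def)
qed

text \<open>At \<open>\<kappa> = z\<close> the value prescribed for the quotient is
  \<open>- bessel_J (m + 1) z / (2 * z)\<close>, which turns the right-hand side into the integral
  of the square; no limit has to be taken. Nonnegativity of \<open>\<kappa>\<close> ensures
  \<open>\<kappa>\<^sup>2 \<noteq> z\<^sup>2\<close> in the other case.\<close>

lemma bessel_quotient_integral:
  fixes m :: int
  assumes "n \<ge> 1" "\<kappa> \<ge> 0"
  defines "z \<equiv> bessel_zero m n"
  shows "((\<lambda>r. r * bessel_J m (\<kappa> * r) * bessel_J m (z * r)) has_integral
    - z * bessel_J (m + 1) z * bessel_quotient m n \<kappa>) {0..1}"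
proof -
  have z: "z > 0" "bessel_J m z = 0"
    using bessel_zero_pos bessel_J_bessel_zero assms(1) by (simp_all add: z_def)
  show ?thesis
  proof (cases "\<kappa> = z")
    case True
    have "deriv (bessel_J m) z = - bessel_J (m + 1) z"
      using bessel_J_has_derivative_zero[OF z] by (rule DERIV_imp_deriv)
    then show ?thesis
      using Lommel_integral_square[OF z(2)] z(1) True
      by (simp add: bessel_quotient_def z_def[symmetric] power2_eq_square)
  next
    case False
    then have "\<kappa>\<^sup>2 \<noteq> z\<^sup>2"
      using assms(2) z(1) by (simp add: power2_eq_iff)
    then show ?thesis
      using Lommel_integral[OF z(2)] False by (simp add: bessel_quotient_def z_def[symmetric])
  qed
qed

text \<open>The leading \<open>r\<close> is the Jacobian of polar coordinates. The cutoff at radius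
  1 is left out, which makes the function continuous everywhere.\<close>

definition FB_radial :: "int \<Rightarrow> nat \<Rightarrow> real \<Rightarrow> real" where
  "FB_radial m n r = r * bessel_J m (bessel_zero m n * r) / (sqrt pi * \<bar>bessel_J (m + 1) (bessel_zero m n)\<bar>)"

lemma continuous_on_FB_radial [continuous_intros]:
  assumes "continuous_on S g"
  shows "continuous_on S (\<lambda>x. FB_radial m n (g x))"
  unfolding FB_radial_def divide_inverse by (intro continuous_intros assms)

lemma FB_coeff_eq:
  "FB_coeff m n f = integral {0..2*pi} (\<lambda>\<theta>. integral {0..1} (\<lambda>r.
     f (r * cos \<theta>, r * sin \<theta>) * (cis (- (real_of_int m * \<theta>)) * of_real (FB_radial m n r))))"
proof -
  have "cnj (FB_Psi m n r \<theta>) * of_real r = cis (- (real_of_int m * \<theta>)) * of_real (FB_radial m n r)" if "r \<in> {0..1}" for r \<theta> :: real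
  proof -
    have "exp (\<i> * of_int m * of_real \<theta>) = cis (real_of_int m * \<theta>)"
      by (simp add: cis_conv_exp mult_ac)
    then show ?thesis
      using that by (simp add: FB_Psi_def FB_radial_def cis_cnj)
  qed
  then show ?thesis
    unfolding FB_coeff_def by (intro integral_cong) (simp add: mult.assoc)
qed

definition fourier_char :: "int \<times> int \<Rightarrow> real \<times> real \<Rightarrow> complex" where
  "fourier_char k p = cis (pi * (real_of_int (fst k) * fst p + real_of_int (snd k) * snd p))"

text \<open>In polar coordinates the character is a plane wave with phase
  \<open>\<kappa> * r * cos (\<theta> - \<phi>)\<close>. The angular integral turns it into
  \<open>bessel_J m (\<kappa> * r)\<close>, and Lommel's integral does the rest. So the weights are
  the Fourier-Bessel coefficients of the characters divided by 4, the area of the square.\<close>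

lemma FB_coeff_fourier_char:
  assumes "n \<ge> 1"
  shows "FB_coeff m n (fourier_char k) = 4 * FFB_weight k m n"
proof -
  define z \<phi> \<kappa> where "z = bessel_zero m n" and "\<phi> = freq_angle k" and "\<kappa> = pi * freq_norm k"
  define s where "s = bessel_sign m * (-1) ^ n"
  define q where "q = bessel_quotient m n \<kappa>"
  have z: "z > 0" "s * bessel_J (m + 1) z < 0"
    using bessel_zero_pos bessel_J_Suc_bessel_zero assms by (simp_all add: z_def s_def)
  have s1: "\<bar>s\<bar> = 1"
    by (auto simp: s_def bessel_sign_def abs_mult power_int_abs power_abs)
  have k: "real_of_int (fst k) = freq_norm k * cos \<phi>" "real_of_int (snd k) = freq_norm k * sin \<phi>"
  proof -
    define w where "w = Complex (real_of_int (fst k)) (real_of_int (snd k))"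
    have "w = rcis (freq_norm k) \<phi>"
      using rcis_cmod_Arg[of w] by (simp add: w_def \<phi>_def freq_angle_def freq_norm_def norm_Pair cmod_def)
    then show "real_of_int (fst k) = freq_norm k * cos \<phi>" "real_of_int (snd k) = freq_norm k * sin \<phi>"
      by (simp_all add: complex_eq_iff w_def)
  qed
  have phase: "fourier_char k (r * cos \<theta>, r * sin \<theta>) * cis (- (real_of_int m * \<theta>))
      = cis ((\<kappa> * r) * cos (\<theta> - \<phi>) - real_of_int m * \<theta>)" for r \<theta> :: real
    unfolding fourier_char_def cis_mult
    by (simp add: k \<kappa>_def cos_diff algebra_simps)
  define h where "h = (\<lambda>\<theta> r. cis ((\<kappa> * r) * cos (\<theta> - \<phi>) - real_of_int m * \<theta>) * of_real (FB_radial m n r))"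
  have "FB_coeff m n (fourier_char k) = integral {0..2*pi} (\<lambda>\<theta>. integral {0..1} (h \<theta>))"
    unfolding FB_coeff_eq h_def mult.assoc[symmetric] phase ..
  also have "\<dots> = integral {0..1} (\<lambda>r. integral {0..2*pi} (\<lambda>\<theta>. h \<theta> r))"
    using integral_swap_continuous[of 0 0 "2*pi" 1 h]
    by (simp add: h_def split_beta continuous_intros)
  also have "\<dots> = integral {0..1} (\<lambda>r. 2 * pi * \<i> powi m * cis (- (real_of_int m * \<phi>)) *
      of_real (bessel_J m (\<kappa> * r) * FB_radial m n r))"
    unfolding h_def integral_mult_left bessel_J_integral by (simp add: mult_ac)
  also have "\<dots> = 2 * pi * \<i> powi m * cis (- (real_of_int m * \<phi>)) *
      of_real (- z * bessel_J (m + 1) z * q / (sqrt pi * \<bar>bessel_J (m + 1) z\<bar>))"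
  proof -
    have "\<kappa> \<ge> 0"
      by (simp add: \<kappa>_def freq_norm_def)
    from has_integral_divide[OF bessel_quotient_integral[OF assms this], of m "sqrt pi * \<bar>bessel_J (m + 1) z\<bar>"]
    have "((\<lambda>r. bessel_J m (\<kappa> * r) * FB_radial m n r) has_integral
        - z * bessel_J (m + 1) z * q / (sqrt pi * \<bar>bessel_J (m + 1) z\<bar>)) {0..1}"
      by (simp add: FB_radial_def z_def q_def mult_ac)
    from integral_unique[OF has_integral_mult_right[OF has_integral_of_real[OF this]]]
    show ?thesis .
  qed
  \<comment> \<open>Dividing by the absolute value leaves only the sign of
    \<open>bessel_J (m + 1) z\<close>, which is opposite to \<open>s\<close>.\<close>
  also have "- z * bessel_J (m + 1) z * q / (sqrt pi * \<bar>bessel_J (m + 1) z\<bar>) = s * z * q / sqrt pi"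
  proof -
    have "s = 1 \<or> s = -1"
      using s1 by linarith
    then show ?thesis
      using z(2) by (auto simp: abs_if)
  qed
  also have "2 * pi * \<i> powi m * cis (- (real_of_int m * \<phi>)) * of_real (s * z * q / sqrt pi) = 4 * FFB_weight k m n"
  proof -
    have "of_real pi = of_real (sqrt pi) * complex_of_real (sqrt pi)"
      by (simp flip: of_real_mult)
    moreover have "exp (- (\<i> * of_int m * of_real \<phi>)) = cis (- (real_of_int m * \<phi>))"
      by (simp add: cis_conv_exp mult_ac)
    ultimately show ?thesis
      unfolding FFB_weight_def \<phi>_def[symmetric] \<kappa>_def[symmetric] q_def[symmetric] z_def[symmetric]
      by (simp add: s_def field_simps)
  qed
  finally show ?thesis .
qed

section \<open>The Fejer-Korovkin kernel on the grid\<close>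

declare sum.cl_ivl_Suc [simp del]

text \<open>A full geometric sum over powers of an \<open>L\<close>-th root of unity. The bound on
  \<open>q\<close> excludes the nonzero multiples of \<open>L\<close>, which the grid cannot
  distinguish from 0.\<close>

lemma sum_cis_grid:
  fixes q :: int
  assumes "\<bar>q\<bar> < int L"
  shows "(\<Sum>i=1..L. cis (pi * real_of_int q * grid_point L i)) = (if q = 0 then of_nat L else 0)"
proof (cases "q = 0")
  case False
  define \<omega> where "\<omega> = cis (2 * pi * real_of_int q / real L)"
  have L: "L > 0"
    using assms by auto
  have "\<omega> \<noteq> 1"
  proof
    assume "\<omega> = 1"
    then have "cos (2 * pi * real_of_int q / real L) = 1"
      unfolding \<omega>_def by (metis cis.sel(1) one_complex.sel(1))
    then obtain j :: int where "2 * pi * real_of_int q / real L = real_of_int j * 2 * pi"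
      unfolding cos_one_2pi_int by blast
    then have "real_of_int q = real_of_int (j * int L)"
      using L by (simp add: field_simps)
    then have "q = j * int L"
      by linarith
    then show False
      using assms False by (simp add: abs_mult zero_less_mult_iff mult_less_cancel_right1)
  qed
  have "cis (pi * real_of_int q * grid_point L (Suc i)) = cis (- (pi * real_of_int q)) * \<omega> ^ i" for i
    unfolding \<omega>_def Complex.DeMoivre cis_mult
    by (simp add: grid_point_def grid_step_def algebra_simps)
  then have "(\<Sum>i=1..L. cis (pi * real_of_int q * grid_point L i)) = cis (- (pi * real_of_int q)) * (\<Sum>i<L. \<omega> ^ i)"
    by (simp add: sum.atLeast1_atMost_eq sum_distrib_left)
  also have "(\<Sum>i<L. \<omega> ^ i) = (\<omega> ^ L - 1) / (\<omega> - 1)"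
    using \<open>\<omega> \<noteq> 1\<close> by (simp add: geometric_sum)
  also have "\<omega> ^ L = 1"
    using L cis_multiple_2pi[of "of_int q"] by (simp add: \<omega>_def Complex.DeMoivre mult_ac)
  finally show ?thesis
    using False by simp
qed simp

text \<open>Among all choices of \<open>K + 1\<close> amplitudes this one maximises the correlation
  of neighbours relative to the sum of squares, and thereby the cosine moment of the kernel. The
  values at the outer indices \<open>0\<close> and \<open>K + 2\<close> are zero.\<close>

definition FK_coeff :: "nat \<Rightarrow> nat \<Rightarrow> real" where
  "FK_coeff K a = sin (real a * (pi / real (K + 2)))"

definition FK_sum :: "nat \<Rightarrow> real \<Rightarrow> complex" where
  "FK_sum K t = (\<Sum>a=1..K+1. of_real (FK_coeff K a) * cis (pi * real a * t))"

definition FK_mass :: "nat \<Rightarrow> real" where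
  "FK_mass K = (\<Sum>a=1..K+1. (FK_coeff K a)\<^sup>2)"

text \<open>The normalisation makes the samples at the \<open>2 * K + 1\<close> grid points sum to 1.\<close>
definition FK_kernel :: "nat \<Rightarrow> real \<Rightarrow> real" where
  "FK_kernel K t = (cmod (FK_sum K t))\<^sup>2 / (real (2 * K + 1) * FK_mass K)"

lemma FK_mass_pos: "FK_mass K > 0"
proof -
  have "0 < FK_coeff K 1"
    unfolding FK_coeff_def by (intro sin_gt_zero) (auto simp: divide_less_eq add_pos_nonneg)
  then show ?thesis
    unfolding FK_mass_def by (intro sum_pos2[where i = 1]) auto
qed

lemma FK_kernel_nonneg: "FK_kernel K t \<ge> 0"
  using FK_mass_pos[of K] by (simp add: FK_kernel_def)

lemma FK_kernel_expand:
  "complex_of_real (FK_kernel K t) = (\<Sum>a=1..K+1. \<Sum>b=1..K+1.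
     of_real (FK_coeff K a * FK_coeff K b / (real (2 * K + 1) * FK_mass K)) * cis (pi * real_of_int (int a - int b) * t))"
proof -
  have "complex_of_real ((cmod (FK_sum K t))\<^sup>2) = FK_sum K t * cnj (FK_sum K t)"
    by (rule complex_norm_square)
  also have "\<dots> = (\<Sum>a=1..K+1. \<Sum>b=1..K+1.
      of_real (FK_coeff K a * FK_coeff K b) * cis (pi * real_of_int (int a - int b) * t))"
    unfolding FK_sum_def cnj_sum sum_product
  proof (intro sum.cong refl)
    fix a b :: nat
    have "cis (pi * real a * t) * cnj (cis (pi * real b * t)) = cis (pi * real_of_int (int a - int b) * t)"
      by (simp add: cis_cnj cis_divide[symmetric] cis_mult algebra_simps)
    then show "of_real (FK_coeff K a) * cis (pi * real a * t) * cnj (of_real (FK_coeff K b) * cis (pi * real b * t))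
        = of_real (FK_coeff K a * FK_coeff K b) * cis (pi * real_of_int (int a - int b) * t)"
      by (simp add: mult_ac)
  qed
  finally show ?thesis
    by (simp add: FK_kernel_def sum_divide_distrib)
qed

text \<open>After expansion only the frequencies with \<open>int a - int b + p = 0\<close> survive
  summation over the grid, and these do not depend on \<open>x\<close>. The case
  \<open>p = 0\<close> gives the mass and \<open>p = 1\<close> the cosine moment.\<close>

lemma FK_kernel_moment:
  assumes "K \<ge> 1" "\<bar>p\<bar> \<le> 1"
  shows "(\<Sum>i=1..2*K+1. of_real (FK_kernel K (x - grid_point (2*K+1) i)) * cis (pi * real_of_int p * (x - grid_point (2*K+1) i)))
    = of_real ((\<Sum>a=1..K+1. \<Sum>b=1..K+1. if int b = int a + p then FK_coeff K a * FK_coeff K b else 0) / FK_mass K)"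
proof -
  define L where "L = 2 * K + 1"
  define N where "N = real L * FK_mass K"
  have L0: "complex_of_nat L \<noteq> 0"
    unfolding L_def of_nat_eq_0_iff by simp
  have "(\<Sum>i=1..L. of_real (FK_kernel K (x - grid_point L i)) * cis (pi * real_of_int p * (x - grid_point L i)))
      = (\<Sum>i=1..L. \<Sum>a=1..K+1. \<Sum>b=1..K+1. of_real (FK_coeff K a * FK_coeff K b / N) *
          cis (pi * real_of_int (int a - int b + p) * (x - grid_point L i)))"
    unfolding FK_kernel_expand sum_distrib_right L_def[symmetric] N_def[symmetric]
    by (intro sum.cong refl) (simp add: mult.assoc cis_mult algebra_simps)
  also have "\<dots> = (\<Sum>a=1..K+1. \<Sum>b=1..K+1. \<Sum>i=1..L. of_real (FK_coeff K a * FK_coeff K b / N) *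
          cis (pi * real_of_int (int a - int b + p) * (x - grid_point L i)))"
    by (rule trans[OF sum.swap sum.cong[OF refl sum.swap]])
  also have "\<dots> = (\<Sum>a=1..K+1. \<Sum>b=1..K+1.
      of_real (if int b = int a + p then FK_coeff K a * FK_coeff K b / FK_mass K else 0))"
  proof (intro sum.cong refl)
    fix a b assume ab: "a \<in> {1..K+1}" "b \<in> {1..K+1}"
    define q where "q = int a - int b + p"
    \<comment> \<open>The frequency is at most \<open>K + 1\<close> in absolute value, which is
      below \<open>2 * K + 1\<close> because \<open>K \<ge> 1\<close>.\<close>
    have "\<bar>- q\<bar> < int L"
      using ab assms by (auto simp: q_def L_def)
    note S = sum_cis_grid[OF this]
    have "cis (pi * real_of_int q * (x - grid_point L i))
        = cis (pi * real_of_int q * x) * cis (pi * real_of_int (- q) * grid_point L i)" for i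
      by (simp add: cis_mult algebra_simps)
    then have "(\<Sum>i=1..L. of_real (FK_coeff K a * FK_coeff K b / N) * cis (pi * real_of_int q * (x - grid_point L i)))
        = of_real (FK_coeff K a * FK_coeff K b / N) * (cis (pi * real_of_int q * x) *
            (\<Sum>i=1..L. cis (pi * real_of_int (- q) * grid_point L i)))"
      by (simp only: sum_distrib_left)
    also have "\<dots> = of_real (if q = 0 then FK_coeff K a * FK_coeff K b / FK_mass K else 0)"
      unfolding S using L0 by (simp add: N_def)
    also have "q = 0 \<longleftrightarrow> int b = int a + p"
      by (auto simp: q_def)
    finally show "(\<Sum>i=1..L. of_real (FK_coeff K a * FK_coeff K b / N) * cis (pi * real_of_int (int a - int b + p) * (x - grid_point L i)))
        = of_real (if int b = int a + p then FK_coeff K a * FK_coeff K b / FK_mass K else 0)"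
      by (simp only: q_def)
  qed
  also have "\<dots> = of_real ((\<Sum>a=1..K+1. \<Sum>b=1..K+1. if int b = int a + p then FK_coeff K a * FK_coeff K b else 0) / FK_mass K)"
    unfolding sum_divide_distrib of_real_sum by (intro sum.cong refl) simp
  finally show ?thesis
    by (simp add: L_def)
qed

lemma sum_FK_kernel:
  assumes "K \<ge> 1"
  shows "(\<Sum>i=1..2*K+1. FK_kernel K (x - grid_point (2*K+1) i)) = 1"
proof -
  have "(\<Sum>a=1..K+1. \<Sum>b=1..K+1. if int b = int a + 0 then FK_coeff K a * FK_coeff K b else 0) = FK_mass K"
    unfolding FK_mass_def
    by (intro sum.cong refl) (simp add: sum.delta if_distrib power2_eq_square cong: if_cong)
  then have "complex_of_real (\<Sum>i=1..2*K+1. FK_kernel K (x - grid_point (2*K+1) i)) = 1"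
    using FK_kernel_moment[OF assms, of 0 x] FK_mass_pos[of K] by simp
  then show ?thesis
    using of_real_eq_1_iff by blast
qed

text \<open>
  The coefficients \<open>sin (a * pi / (K + 2))\<close> form an eigenvector of the averaging of
  neighbours, with eigenvalue \<open>cos (pi / (K + 2))\<close>.
\<close>
lemma sum_FK_coeff_neighbours:
  "(\<Sum>a=1..K+1. FK_coeff K a * FK_coeff K (Suc a)) = cos (pi / real (K + 2)) * FK_mass K"
proof -
  define \<alpha> where "\<alpha> = pi / real (K + 2)"
  define s where "s = FK_coeff K"
  have s0: "s 0 = 0" and sK: "s (K + 2) = 0"
    by (simp_all add: s_def FK_coeff_def)
  have rec: "s (a - 1) + s (Suc a) = 2 * cos \<alpha> * s a" if "a \<ge> 1" for a
  proof -
    have "s (a - 1) = sin (real a * \<alpha> - \<alpha>)" "s (Suc a) = sin (real a * \<alpha> + \<alpha>)" "s a = sin (real a * \<alpha>)"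
      using that by (simp_all add: s_def FK_coeff_def \<alpha>_def of_nat_diff algebra_simps add_divide_distrib diff_divide_distrib)
    then show ?thesis
      by (simp add: sin_add sin_diff)
  qed
  have "(\<Sum>a=1..K+1. s a * s (a - 1)) = (\<Sum>a=0..K. s (Suc a) * s a)"
    using sum.shift_bounds_cl_Suc_ivl[of "\<lambda>a. s a * s (a - 1)" 0 K] by simp
  \<comment> \<open>The range is moved back at no cost: the term added at \<open>a = K + 1\<close>
    contains \<open>s (K + 2) = 0\<close>, and the term dropped afterwards contains
    \<open>s 0 = 0\<close>.\<close>
  also have "\<dots> = (\<Sum>a=0..Suc K. s a * s (Suc a))"
    using sK by (simp add: sum.cl_ivl_Suc mult.commute)
  also have "\<dots> = (\<Sum>a=1..K+1. s a * s (Suc a))"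
    using s0 by (subst sum.atLeast_Suc_atMost) auto
  finally have "2 * (\<Sum>a=1..K+1. s a * s (Suc a)) = (\<Sum>a=1..K+1. s a * (s (a - 1) + s (Suc a)))"
    by (simp add: distrib_left sum.distrib)
  also have "\<dots> = (\<Sum>a=1..K+1. s a * (2 * cos \<alpha> * s a))"
    by (intro sum.cong refl) (simp only: rec atLeastAtMost_iff)
  also have "\<dots> = 2 * (cos \<alpha> * FK_mass K)"
    by (simp add: FK_mass_def s_def sum_distrib_left power2_eq_square mult_ac)
  finally show ?thesis
    by (simp add: s_def \<alpha>_def)
qed

lemma sum_FK_kernel_cos:
  assumes "K \<ge> 1"
  shows "(\<Sum>i=1..2*K+1. FK_kernel K (x - grid_point (2*K+1) i) * cos (pi * (x - grid_point (2*K+1) i))) = cos (pi / real (K + 2))"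
proof -
  have "(\<Sum>b=1..K+1. if int b = int a + 1 then FK_coeff K a * FK_coeff K b else 0) = FK_coeff K a * FK_coeff K (Suc a)"
    if "a \<in> {1..K+1}" for a
  proof -
    have "(\<Sum>b=1..K+1. if int b = int a + 1 then FK_coeff K a * FK_coeff K b else 0)
        = (\<Sum>b=1..K+1. if b = Suc a then FK_coeff K a * FK_coeff K (Suc a) else 0)"
      by (intro sum.cong refl) auto
    also have "\<dots> = (if Suc a \<in> {1..K+1} then FK_coeff K a * FK_coeff K (Suc a) else 0)"
      by (intro sum.delta) simp
    also have "\<dots> = FK_coeff K a * FK_coeff K (Suc a)"
    \<comment> \<open>The last \<open>a\<close> has no partner \<open>b\<close> in range, but its
      product vanishes anyway since \<open>FK_coeff K (K + 2) = 0\<close>.\<close>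
    proof (cases "Suc a \<in> {1..K+1}")
      case False
      then have "Suc a = K + 2"
        using that by auto
      then have "FK_coeff K (Suc a) = 0"
        by (simp add: FK_coeff_def)
      then show ?thesis
        by simp
    qed simp
    finally show ?thesis .
  qed
  then have "(\<Sum>a=1..K+1. \<Sum>b=1..K+1. if int b = int a + 1 then FK_coeff K a * FK_coeff K b else 0)
      = cos (pi / real (K + 2)) * FK_mass K"
    unfolding sum_FK_coeff_neighbours[symmetric] by (rule sum.cong[OF refl])
  then have "(\<Sum>i=1..2*K+1. of_real (FK_kernel K (x - grid_point (2*K+1) i)) * cis (pi * (x - grid_point (2*K+1) i)))
      = complex_of_real (cos (pi / real (K + 2)))"
    using FK_kernel_moment[OF assms, of 1 x] FK_mass_pos[of K] by simp
  then have "Re (\<Sum>i=1..2*K+1. of_real (FK_kernel K (x - grid_point (2*K+1) i)) * cis (pi * (x - grid_point (2*K+1) i)))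
      = cos (pi / real (K + 2))"
    by (metis Re_complex_of_real)
  then show ?thesis
    by simp
qed

text \<open>The kernel values on the grid are probability weights, so the first moment is at most
  the root of the second, and the latter is \<open>(sin (\<alpha> / 2))\<^sup>2\<close> by the
  cosine moment. The function \<open>\<bar>sin (pi * t / 2)\<bar>\<close> replaces the 2-periodic
  distance because its square is linear in the cosine.\<close>

lemma sum_FK_kernel_abs_sin:
  assumes "K \<ge> 1"
  shows "(\<Sum>i=1..2*K+1. FK_kernel K (x - grid_point (2*K+1) i) * \<bar>sin (pi * (x - grid_point (2*K+1) i) / 2)\<bar>) \<le> pi / (2 * real K)"
proof -
  define t where "t = (\<lambda>i. x - grid_point (2*K+1) i)"
  define k where "k = (\<lambda>i. FK_kernel K (t i))"
  define u where "u = (\<lambda>i. sin (pi * t i / 2))"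
  define \<alpha> where "\<alpha> = pi / real (K + 2)"
  have k0: "k i \<ge> 0" for i
    by (simp add: k_def FK_kernel_nonneg)
  have k1: "(\<Sum>i=1..2*K+1. k i) = 1"
    using sum_FK_kernel[OF assms] by (simp add: k_def t_def)
  have "cos (pi * t i) = 1 - 2 * (u i)\<^sup>2" for i
    using cos_double_sin[of "pi * t i / 2"] by (simp add: u_def)
  then have "2 * (k i * (u i)\<^sup>2) = k i - k i * cos (pi * t i)" for i
    by (simp only:) (simp add: algebra_simps)
  then have "2 * (\<Sum>i=1..2*K+1. k i * (u i)\<^sup>2) = (\<Sum>i=1..2*K+1. k i) - (\<Sum>i=1..2*K+1. k i * cos (pi * t i))"
    by (simp only: sum_distrib_left sum_subtractf)
  also have "\<dots> = 1 - cos \<alpha>"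
    using sum_FK_kernel_cos[OF assms, of x] k1 by (simp only: k_def t_def \<alpha>_def)
  also have "\<dots> = 2 * (sin (\<alpha> / 2))\<^sup>2"
    using cos_double_sin[of "\<alpha> / 2"] by simp
  finally have ku2: "(\<Sum>i=1..2*K+1. k i * (u i)\<^sup>2) = (sin (\<alpha> / 2))\<^sup>2"
    by simp
  have "(\<Sum>i=1..2*K+1. k i * \<bar>u i\<bar>)\<^sup>2 = (\<Sum>i=1..2*K+1. sqrt (k i) * (sqrt (k i) * \<bar>u i\<bar>))\<^sup>2"
    using k0 by (simp add: mult.assoc[symmetric])
  also have "\<dots> \<le> (\<Sum>i=1..2*K+1. (sqrt (k i))\<^sup>2) * (\<Sum>i=1..2*K+1. (sqrt (k i) * \<bar>u i\<bar>)\<^sup>2)"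
    by (rule Cauchy_Schwarz_ineq_sum)
  also have "\<dots> = (sin (\<alpha> / 2))\<^sup>2"
    using k0 k1 ku2 by (simp add: power_mult_distrib)
  finally have "(\<Sum>i=1..2*K+1. k i * \<bar>u i\<bar>) \<le> \<bar>sin (\<alpha> / 2)\<bar>"
    using k0 by (simp add: abs_le_square_iff[symmetric] sum_nonneg)
  also have "\<dots> \<le> \<bar>\<alpha> / 2\<bar>"
    by (rule abs_sin_x_le_abs_x)
  also have "\<dots> \<le> pi / (2 * real K)"
    using assms by (simp add: \<alpha>_def field_simps)
  finally show ?thesis
    by (simp add: k_def u_def t_def)
qed

section \<open>Exactness on trigonometric polynomials\<close>

definition freq_box :: "nat \<Rightarrow> (int \<times> int) set" where
  "freq_box K = {- int K..int K} \<times> {- int K..int K}"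

lemma finite_freq_box [simp, intro]: "finite (freq_box K)"
  by (simp add: freq_box_def)

lemma FFB_coeff_eq: "FFB_coeff K m n f = (\<Sum>k\<in>freq_box K. FFB_weight k m n * finite_fourier f k (2 * K + 1))"
proof -
  have "{k. max \<bar>fst k\<bar> \<bar>snd k\<bar> \<le> int K} = freq_box K"
    by (auto simp: freq_box_def)
  then show ?thesis
    by (simp add: FFB_coeff_def)
qed

lemma finite_fourier_eq:
  "finite_fourier f k L = of_real ((grid_step L)\<^sup>2) *
     (\<Sum>i=1..L. \<Sum>j=1..L. f (grid_point L i, grid_point L j) * cnj (fourier_char k (grid_point L i, grid_point L j)))"
proof -
  have "exp (- (of_real pi * \<i> * of_real x)) = cnj (cis (pi * x))" for x
    by (simp only: cis_cnj) (simp add: cis_conv_exp mult_ac)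
  then show ?thesis
    by (simp only: finite_fourier_def fourier_char_def fst_conv snd_conv)
qed

text \<open>Frequencies in the box differ by at most \<open>2 * K\<close> in each component, so
  \<open>2 * K + 1\<close> points per axis separate them.\<close>

lemma fourier_char_grid_orthogonal:
  assumes "k \<in> freq_box K" "l \<in> freq_box K"
  defines "x \<equiv> grid_point (2 * K + 1)"
  shows "(\<Sum>i=1..2*K+1. \<Sum>j=1..2*K+1. fourier_char k (x i, x j) * cnj (fourier_char l (x i, x j)))
    = (if k = l then of_nat (2 * K + 1) ^ 2 else 0)"
proof -
  have "\<bar>fst k - fst l\<bar> < int (2 * K + 1)" "\<bar>snd k - snd l\<bar> < int (2 * K + 1)"
    using assms(1,2) by (auto simp: freq_box_def)
  note S = this[THEN sum_cis_grid]
  have "fourier_char k (x i, x j) * cnj (fourier_char l (x i, x j))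
      = cis (pi * real_of_int (fst k - fst l) * x i) * cis (pi * real_of_int (snd k - snd l) * x j)" for i j
    unfolding fourier_char_def cis_cnj cis_mult by (simp add: algebra_simps)
  then have "(\<Sum>i=1..2*K+1. \<Sum>j=1..2*K+1. fourier_char k (x i, x j) * cnj (fourier_char l (x i, x j)))
      = (\<Sum>i=1..2*K+1. cis (pi * real_of_int (fst k - fst l) * x i)) *
        (\<Sum>j=1..2*K+1. cis (pi * real_of_int (snd k - snd l) * x j))"
    by (simp only: sum_product)
  also have "\<dots> = (if k = l then of_nat (2 * K + 1) ^ 2 else 0)"
    unfolding x_def S by (auto simp: power2_eq_square prod_eq_iff)
  finally show ?thesis .
qed

text \<open>On the box the finite transform of a character is 4 at its own frequency and 0
  elsewhere: the factor \<open>(2 / L)\<^sup>2\<close> meets \<open>L\<^sup>2\<close> equal samples.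
  This is the same 4 as for the exact coefficient.\<close>

lemma FFB_coeff_fourier_char:
  assumes "k \<in> freq_box K"
  shows "FFB_coeff K m n (fourier_char k) = 4 * FFB_weight k m n"
proof -
  have L0: "of_nat (2 * K + 1) \<noteq> (0::complex)"
    unfolding of_nat_eq_0_iff by simp
  have "finite_fourier (fourier_char k) l (2 * K + 1) = (if l = k then 4 else 0)" if "l \<in> freq_box K" for l
  proof -
    have "finite_fourier (fourier_char k) l (2 * K + 1)
        = of_real ((grid_step (2 * K + 1))\<^sup>2) * (if k = l then of_nat (2 * K + 1) ^ 2 else 0)"
      unfolding finite_fourier_eq using fourier_char_grid_orthogonal[OF assms that] by simp
    also have "complex_of_real ((grid_step (2 * K + 1))\<^sup>2) = 4 / of_nat (2 * K + 1) ^ 2"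
      by (simp add: grid_step_def power_divide)
    finally show ?thesis
      using L0 by auto
  qed
  then have "FFB_coeff K m n (fourier_char k) = (\<Sum>l\<in>freq_box K. if l = k then FFB_weight k m n * 4 else 0)"
    unfolding FFB_coeff_eq by (intro sum.cong refl) auto
  then show ?thesis
    using assms by (simp add: mult.commute)
qed

section \<open>Linearity and sup-norm bound of the finite transform\<close>

lemma FFB_coeff_add: "FFB_coeff K m n (\<lambda>p. f p + g p) = FFB_coeff K m n f + FFB_coeff K m n g"
  by (simp add: FFB_coeff_eq finite_fourier_eq distrib_left distrib_right sum.distrib)

lemma FFB_coeff_cmult: "FFB_coeff K m n (\<lambda>p. c * f p) = c * FFB_coeff K m n f"
  unfolding FFB_coeff_eq finite_fourier_eq sum_distrib_left
  by (intro sum.cong refl) (simp only: mult_ac)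

lemma FFB_coeff_sum:
  assumes "finite A"
  shows "FFB_coeff K m n (\<lambda>p. \<Sum>k\<in>A. c k * g k p) = (\<Sum>k\<in>A. c k * FFB_coeff K m n (g k))"
  using assms
proof induction
  case empty
  show ?case
    using FFB_coeff_cmult[of K m n 0 "\<lambda>_. 0"] by simp
next
  case (insert k A)
  then show ?case
    by (simp add: FFB_coeff_add FFB_coeff_cmult)
qed

text \<open>Write the sum as a pairing of the samples of \<open>g\<close> with a trigonometric polynomial
  and apply Cauchy-Schwarz and the discrete Parseval identity to the latter.\<close>
lemma norm_FFB_coeff_le:
  assumes G: "\<And>i j. i \<in> {1..2*K+1} \<Longrightarrow> j \<in> {1..2*K+1} \<Longrightarrow>
      cmod (g (grid_point (2*K+1) i, grid_point (2*K+1) j)) \<le> G"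
  shows "cmod (FFB_coeff K m n g) \<le> 4 * G * sqrt (\<Sum>k\<in>freq_box K. (cmod (FFB_weight k m n))\<^sup>2)"
proof -
  define L where "L = 2 * K + 1"
  define I where "I = {1..L} \<times> {1..L}"
  define P where "P = (\<lambda>(i, j). (grid_point L i, grid_point L j))"
  define w where "w = (\<lambda>k. FFB_weight k m n)"
  define W where "W = (\<lambda>a. \<Sum>k\<in>freq_box K. w k * cnj (fourier_char k (P a)))"
  define S where "S = (\<Sum>k\<in>freq_box K. (cmod (w k))\<^sup>2)"
  have G0: "G \<ge> 0"
    using order_trans[OF norm_ge_zero G[of 1 1]] by simp
  have "FFB_coeff K m n g = of_real ((grid_step L)\<^sup>2) * (\<Sum>k\<in>freq_box K. \<Sum>a\<in>I. g (P a) * (w k * cnj (fourier_char k (P a))))"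
    unfolding FFB_coeff_eq finite_fourier_eq L_def[symmetric] I_def P_def w_def sum_distrib_left
    by (intro sum.cong refl) (simp add: sum.cartesian_product split_beta mult_ac)
  also have "\<dots> = of_real ((grid_step L)\<^sup>2) * (\<Sum>a\<in>I. g (P a) * W a)"
    unfolding W_def sum_distrib_left by (subst sum.swap) (rule refl)
  finally have FFB: "FFB_coeff K m n g = of_real ((grid_step L)\<^sup>2) * (\<Sum>a\<in>I. g (P a) * W a)" .
  have "complex_of_real (\<Sum>a\<in>I. (cmod (W a))\<^sup>2) = (\<Sum>a\<in>I. cnj (W a) * W a)"
    unfolding of_real_sum complex_norm_square by (simp only: mult.commute)
  also have "\<dots> = (\<Sum>a\<in>I. \<Sum>k\<in>freq_box K. \<Sum>l\<in>freq_box K.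
      cnj (w k) * w l * (fourier_char k (P a) * cnj (fourier_char l (P a))))"
    unfolding W_def cnj_sum sum_product by (intro sum.cong refl) (simp add: mult_ac)
  also have "\<dots> = (\<Sum>k\<in>freq_box K. \<Sum>l\<in>freq_box K. \<Sum>a\<in>I.
      cnj (w k) * w l * (fourier_char k (P a) * cnj (fourier_char l (P a))))"
    by (rule trans[OF sum.swap sum.cong[OF refl sum.swap]])
  also have "\<dots> = (\<Sum>k\<in>freq_box K. \<Sum>l\<in>freq_box K. if k = l then of_nat L ^ 2 * (cnj (w k) * w l) else 0)"
  proof (intro sum.cong refl)
    fix k l assume kl: "k \<in> freq_box K" "l \<in> freq_box K"
    have "(\<Sum>a\<in>I. fourier_char k (P a) * cnj (fourier_char l (P a))) = (if k = l then of_nat L ^ 2 else 0)"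
      using fourier_char_grid_orthogonal[OF kl]
      by (simp add: I_def P_def L_def sum.cartesian_product split_beta)
    then show "(\<Sum>a\<in>I. cnj (w k) * w l * (fourier_char k (P a) * cnj (fourier_char l (P a))))
        = (if k = l then of_nat L ^ 2 * (cnj (w k) * w l) else 0)"
      by (simp add: sum_distrib_left[symmetric])
  qed
  also have "\<dots> = (\<Sum>k\<in>freq_box K. of_nat L ^ 2 * of_real ((cmod (w k))\<^sup>2))"
    by (simp add: complex_norm_square mult_ac del: of_real_power)
  also have "\<dots> = of_real ((real L)\<^sup>2 * S)"
    by (simp add: S_def sum_distrib_left)
  finally have Parseval: "(\<Sum>a\<in>I. (cmod (W a))\<^sup>2) = (real L)\<^sup>2 * S"
    unfolding of_real_eq_iff .
  \<comment> \<open>The resulting bound \<open>L\<^sup>2 * sqrt S\<close> has its factor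
    \<open>L\<^sup>2\<close> cancelled by the squared grid step, which leaves 4 and no dependence on
    the grid.\<close>
  have "(\<Sum>a\<in>I. cmod (W a))\<^sup>2 \<le> (\<Sum>a\<in>I. (cmod (W a))\<^sup>2) * card I"
    by (rule sum_squared_le_sum_of_squares)
  also have "\<dots> = ((real L)\<^sup>2 * sqrt S)\<^sup>2"
    unfolding Parseval by (simp add: I_def power_mult_distrib power2_eq_square S_def sum_nonneg)
  finally have W: "(\<Sum>a\<in>I. cmod (W a)) \<le> (real L)\<^sup>2 * sqrt S"
    by (rule power2_le_imp_le) (simp add: S_def sum_nonneg)
  have "cmod (\<Sum>a\<in>I. g (P a) * W a) \<le> (\<Sum>a\<in>I. G * cmod (W a))"
    using G by (intro sum_norm_le)
      (auto simp: norm_mult I_def P_def L_def intro!: mult_right_mono)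
  also have "\<dots> \<le> G * ((real L)\<^sup>2 * sqrt S)"
    unfolding sum_distrib_left[symmetric] by (rule mult_left_mono[OF W G0])
  finally have "(grid_step L)\<^sup>2 * cmod (\<Sum>a\<in>I. g (P a) * W a) \<le> (grid_step L)\<^sup>2 * (G * ((real L)\<^sup>2 * sqrt S))"
    by (rule mult_left_mono) simp
  also have "\<dots> = (grid_step L * real L)\<^sup>2 * G * sqrt S"
    by (simp add: power_mult_distrib)
  also have "grid_step L * real L = 2"
  proof -
    have "L > 0"
      by (simp add: L_def)
    then show ?thesis
      by (simp add: grid_step_def)
  qed
  finally show ?thesis
    by (simp add: FFB norm_mult S_def w_def norm_power)
qed

section \<open>Linearity and sup-norm bound of the Fourier-Bessel coefficient\<close>

lemma FB_integrand_continuous: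
  assumes "continuous_on UNIV f"
  shows "continuous_on S (\<lambda>(\<theta>, r). f (r * cos \<theta>, r * sin \<theta>) * (cis (- (real_of_int m * \<theta>)) * of_real (FB_radial m n r)))"
  unfolding split_beta
  by (intro continuous_intros continuous_on_compose2[OF assms]) auto

lemma FB_inner_continuous:
  assumes "continuous_on UNIV f"
  shows "continuous_on S (\<lambda>\<theta>. integral {0..1} (\<lambda>r.
    f (r * cos \<theta>, r * sin \<theta>) * (cis (- (real_of_int m * \<theta>)) * of_real (FB_radial m n r))))"
  using integral_continuous_on_param[OF FB_integrand_continuous[OF assms], of S 0 "1::real" m n] by simp

lemma FB_row_continuous:
  assumes "continuous_on UNIV f"
  shows "continuous_on S (\<lambda>r. f (r * cos \<theta>, r * sin \<theta>) * (cis (- (real_of_int m * \<theta>)) * of_real (FB_radial m n r)))"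
  by (intro continuous_intros continuous_on_compose2[OF assms]) auto

lemma FB_coeff_add:
  assumes "continuous_on UNIV f" "continuous_on UNIV g"
  shows "FB_coeff m n (\<lambda>p. f p + g p) = FB_coeff m n f + FB_coeff m n g"
  unfolding FB_coeff_eq distrib_right
  by (simp add: integral_add integrable_continuous_real FB_row_continuous FB_inner_continuous assms)

lemma FB_coeff_cmult: "FB_coeff m n (\<lambda>p. c * f p) = c * FB_coeff m n f"
  unfolding FB_coeff_eq mult.assoc integral_mult_right ..

lemma FB_coeff_sum:
  assumes "finite A" "\<And>k. k \<in> A \<Longrightarrow> continuous_on UNIV (g k)"
  shows "FB_coeff m n (\<lambda>p. \<Sum>k\<in>A. c k * g k p) = (\<Sum>k\<in>A. c k * FB_coeff m n (g k))"
  using assms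
proof induction
  case empty
  show ?case
    using FB_coeff_cmult[of m n 0 "\<lambda>_. 0"] by simp
next
  case (insert k A)
  then show ?case
    by (simp add: FB_coeff_add FB_coeff_cmult continuous_on_mult_left continuous_on_sum)
qed

lemma abs_FB_radial_le:
  assumes "r \<in> {0..1}"
  shows "\<bar>FB_radial m n r\<bar> \<le> 1 / (sqrt pi * \<bar>bessel_J (m + 1) (bessel_zero m n)\<bar>)"
proof -
  have "\<bar>r * bessel_J m (bessel_zero m n * r)\<bar> \<le> 1 * 1"
    unfolding abs_mult using assms abs_bessel_J_le by (intro mult_mono) auto
  then show ?thesis
    by (simp add: FB_radial_def abs_divide abs_mult divide_right_mono)
qed

text \<open>The integral only sees the closed unit disk. The bound is asked for on the surrounding
  square, since that is where the approximation error is controlled.\<close>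

lemma norm_FB_coeff_le:
  assumes g: "continuous_on UNIV g" and G: "\<And>x y. \<bar>x\<bar> \<le> 1 \<Longrightarrow> \<bar>y\<bar> \<le> 1 \<Longrightarrow> cmod (g (x, y)) \<le> G"
  shows "cmod (FB_coeff m n g) \<le> 2 * pi * G / (sqrt pi * \<bar>bessel_J (m + 1) (bessel_zero m n)\<bar>)"
proof -
  define R where "R = 1 / (sqrt pi * \<bar>bessel_J (m + 1) (bessel_zero m n)\<bar>)"
  have "cmod (integral {0..1} (\<lambda>r. g (r * cos \<theta>, r * sin \<theta>) * (cis (- (real_of_int m * \<theta>)) * of_real (FB_radial m n r))))
      \<le> G * R * (1 - 0)" for \<theta>
  proof (rule integral_bound)
    fix r :: real assume r: "r \<in> {0..1}"
    have "\<bar>r * cos \<theta>\<bar> \<le> 1 * 1" "\<bar>r * sin \<theta>\<bar> \<le> 1 * 1"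
      unfolding abs_mult using r by (intro mult_mono; simp)+
    then have "cmod (g (r * cos \<theta>, r * sin \<theta>)) \<le> G"
      by (intro G) auto
    then show "cmod (g (r * cos \<theta>, r * sin \<theta>) * (cis (- (real_of_int m * \<theta>)) * of_real (FB_radial m n r))) \<le> G * R"
      using abs_FB_radial_le[OF r, of m n, folded R_def] by (simp add: norm_mult mult_mono')
  qed (auto intro: FB_row_continuous[OF g])
  from integral_bound[OF _ FB_inner_continuous[OF g] this, of 0 "2 * pi"]
  have "cmod (FB_coeff m n g) \<le> G * R * (1 - 0) * (2 * pi - 0)"
    unfolding FB_coeff_eq by simp
  then show ?thesis
    by (simp add: R_def mult_ac)
qed

section \<open>Trigonometric polynomials and the grid approximant\<close>

definition trig_poly :: "nat \<Rightarrow> (real \<times> real \<Rightarrow> complex) \<Rightarrow> bool" where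
  "trig_poly K g \<longleftrightarrow> (\<exists>c. g = (\<lambda>p. \<Sum>k\<in>freq_box K. c k * fourier_char k p))"

lemma continuous_on_fourier_char: "continuous_on S (fourier_char k)"
  unfolding fourier_char_def by (intro continuous_intros)

lemma trig_poly_continuous: "trig_poly K g \<Longrightarrow> continuous_on S g"
  unfolding trig_poly_def by (auto intro!: continuous_intros continuous_on_fourier_char)

lemma trig_poly_fourier_char:
  assumes "k \<in> freq_box K"
  shows "trig_poly K (fourier_char k)"
  unfolding trig_poly_def
  by (rule exI[of _ "\<lambda>l. if l = k then 1 else 0"]) (use assms in \<open>simp add: if_distrib[of "\<lambda>x. x * _"] cong: if_cong\<close>)

lemma trig_poly_cmult: "trig_poly K g \<Longrightarrow> trig_poly K (\<lambda>p. a * g p)"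
  unfolding trig_poly_def by (elim exE, rule_tac x = "\<lambda>k. a * c k" in exI) (simp add: sum_distrib_left mult.assoc)

lemma trig_poly_add: "trig_poly K f \<Longrightarrow> trig_poly K g \<Longrightarrow> trig_poly K (\<lambda>p. f p + g p)"
  unfolding trig_poly_def
  by (elim exE, rule_tac x = "\<lambda>k. c k + ca k" in exI) (simp add: sum.distrib distrib_right)

lemma trig_poly_sum: "(\<And>a. a \<in> A \<Longrightarrow> trig_poly K (g a)) \<Longrightarrow> trig_poly K (\<lambda>p. \<Sum>a\<in>A. g a p)"
proof (induction A rule: infinite_finite_induct)
  case (insert a A)
  then show ?case
    by (simp add: trig_poly_add)
qed (auto simp: trig_poly_def intro!: exI[of _ "\<lambda>_. 0"])

lemma FB_coeff_trig_poly:
  assumes "trig_poly K g" "n \<ge> 1"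
  shows "FB_coeff m n g = FFB_coeff K m n g"
proof -
  obtain c where g: "g = (\<lambda>p. \<Sum>k\<in>freq_box K. c k * fourier_char k p)"
    using assms(1) by (auto simp: trig_poly_def)
  show ?thesis
    unfolding g by (simp add: FB_coeff_sum FFB_coeff_sum continuous_on_fourier_char
        FB_coeff_fourier_char[OF assms(2)] FFB_coeff_fourier_char)
qed

text \<open>A convolution operator of Jackson type with the integral replaced by a sum over the grid
  and the tensor product of the kernel with itself in the two variables.\<close>

definition FK_approx :: "nat \<Rightarrow> (real \<times> real \<Rightarrow> complex) \<Rightarrow> real \<times> real \<Rightarrow> complex" where
  "FK_approx K f p = (let x = grid_point (2 * K + 1) in \<Sum>i=1..2*K+1. \<Sum>j=1..2*K+1.
     f (x i, x j) * of_real (FK_kernel K (fst p - x i) * FK_kernel K (snd p - x j)))"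

text \<open>Translation by a grid point multiplies the Fourier coefficients of the kernel by phases
  only, and differences of indices from \<open>1..K+1\<close> stay within
  \<open>-K..K\<close>.\<close>

lemma trig_poly_FK_approx: "trig_poly K (FK_approx K f)"
proof -
  define s where "s = (\<lambda>a b. complex_of_real (FK_coeff K a * FK_coeff K b / (real (2 * K + 1) * FK_mass K)))"
  have expand: "of_real (FK_kernel K t) = (\<Sum>a=1..K+1. \<Sum>b=1..K+1. s a b * cis (pi * real_of_int (int a - int b) * t))" for t
    by (simp only: FK_kernel_expand s_def)
  have "trig_poly K (\<lambda>p. of_real (FK_kernel K (fst p - u) * FK_kernel K (snd p - v)))" for u v
  proof -
    have "of_real (FK_kernel K (fst p - u) * FK_kernel K (snd p - v)) = 
        (\<Sum>a=1..K+1. \<Sum>a'=1..K+1. \<Sum>b=1..K+1. \<Sum>b'=1..K+1.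
          (s a b * s a' b' * cis (- (pi * real_of_int (int a - int b) * u + pi * real_of_int (int a' - int b') * v)))
          * fourier_char (int a - int b, int a' - int b') p)" for p
    proof -
      have "cis (- (pi * real_of_int q * u + pi * real_of_int q' * v)) * fourier_char (q, q') p
          = cis (pi * real_of_int q * (fst p - u)) * cis (pi * real_of_int q' * (snd p - v))" for q q'
        unfolding fourier_char_def cis_mult by (simp add: algebra_simps)
      then show ?thesis
        unfolding of_real_mult expand sum_product
        by (intro sum.cong refl) (simp only: mult.assoc, simp only: mult.left_commute)
    qed
    moreover have "trig_poly K (\<lambda>p. \<Sum>a=1..K+1. \<Sum>a'=1..K+1. \<Sum>b=1..K+1. \<Sum>b'=1..K+1.
          (s a b * s a' b' * cis (- (pi * real_of_int (int a - int b) * u + pi * real_of_int (int a' - int b') * v)))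
          * fourier_char (int a - int b, int a' - int b') p)"
      by (intro trig_poly_sum trig_poly_cmult trig_poly_fourier_char) (auto simp: freq_box_def)
    ultimately show ?thesis
      by (simp only:)
  qed
  then show ?thesis
    unfolding FK_approx_def Let_def by (intro trig_poly_sum trig_poly_cmult)
qed

lemma grid_point_abs_le:
  assumes "i \<in> {1..L}"
  shows "\<bar>grid_point L i\<bar> \<le> 1"
proof -
  have "0 \<le> (real i - 1) * 2 / real L" "(real i - 1) * 2 / real L \<le> 2"
    using assms by (auto simp: divide_le_eq)
  then show ?thesis
    by (simp add: grid_point_def grid_step_def abs_le_iff)
qed

text \<open>The weights \<open>k i * l j\<close> sum to 1, so the error is a weighted mean of
  differences of \<open>f\<close>. The Lipschitz bound splits by variable; in each part the other
  kernel sums to 1, and each variable contributes \<open>pi / (2 * K)\<close>.\<close>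

lemma FK_approx_error:
  assumes K: "K \<ge> 1"
    and M: "\<And>x x' y y'. \<lbrakk>\<bar>x\<bar> \<le> 1; \<bar>x'\<bar> \<le> 1; \<bar>y\<bar> \<le> 1; \<bar>y'\<bar> \<le> 1\<rbrakk> \<Longrightarrow>
      cmod (f (x, y) - f (x', y')) \<le> M * (\<bar>sin (pi * (x - x') / 2)\<bar> + \<bar>sin (pi * (y - y') / 2)\<bar>)"
    and xy: "\<bar>x\<bar> \<le> 1" "\<bar>y\<bar> \<le> 1" and "M \<ge> 0"
  shows "cmod (f (x, y) - FK_approx K f (x, y)) \<le> M * pi / real K"
proof -
  define t where "t = grid_point (2 * K + 1)"
  define I where "I = {1..2 * K + 1}"
  define k l where "k = (\<lambda>i. FK_kernel K (x - t i))" and "l = (\<lambda>i. FK_kernel K (y - t i))"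
  define u v where "u = (\<lambda>i. \<bar>sin (pi * (x - t i) / 2)\<bar>)" and "v = (\<lambda>i. \<bar>sin (pi * (y - t i) / 2)\<bar>)"
  have k0: "k i \<ge> 0" and l0: "l i \<ge> 0" for i
    by (simp_all add: k_def l_def FK_kernel_nonneg)
  have k1: "sum k I = 1" and l1: "sum l I = 1"
    using sum_FK_kernel[OF K] by (simp_all add: k_def l_def t_def I_def)
  have ku: "(\<Sum>i\<in>I. k i * u i) \<le> pi / (2 * real K)" and lv: "(\<Sum>i\<in>I. l i * v i) \<le> pi / (2 * real K)"
    using sum_FK_kernel_abs_sin[OF K] by (simp_all add: k_def l_def u_def v_def t_def I_def)
  have "(\<Sum>i\<in>I. \<Sum>j\<in>I. k i * l j) = 1"
    using sum_product[of k I l I] k1 l1 by simp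
  then have "f (x, y) = f (x, y) * of_real (\<Sum>i\<in>I. \<Sum>j\<in>I. k i * l j)"
    by simp
  also have "\<dots> = (\<Sum>i\<in>I. \<Sum>j\<in>I. f (x, y) * of_real (k i * l j))"
    by (simp only: of_real_sum sum_distrib_left)
  finally have *: "f (x, y) = (\<Sum>i\<in>I. \<Sum>j\<in>I. f (x, y) * of_real (k i * l j))" .
  have "FK_approx K f (x, y) = (\<Sum>i\<in>I. \<Sum>j\<in>I. f (t i, t j) * of_real (k i * l j))"
    by (simp only: FK_approx_def Let_def k_def l_def t_def I_def fst_conv snd_conv)
  then have "f (x, y) - FK_approx K f (x, y) = (\<Sum>i\<in>I. \<Sum>j\<in>I. (f (x, y) - f (t i, t j)) * of_real (k i * l j))"
    by (simp only: left_diff_distrib sum_subtractf *[symmetric])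
  also have "cmod \<dots> \<le> (\<Sum>i\<in>I. \<Sum>j\<in>I. M * (u i + v j) * (k i * l j))"
  proof (intro sum_norm_le)
    fix i j assume "i \<in> I" "j \<in> I"
    then have "cmod (f (x, y) - f (t i, t j)) \<le> M * (u i + v j)"
      unfolding u_def v_def t_def I_def by (intro M xy grid_point_abs_le)
    then show "cmod ((f (x, y) - f (t i, t j)) * of_real (k i * l j)) \<le> M * (u i + v j) * (k i * l j)"
      using k0[of i] l0[of j] by (simp add: norm_mult mult_right_mono)
  qed
  also have "\<dots> = M * ((\<Sum>i\<in>I. \<Sum>j\<in>I. (k i * u i) * l j) + (\<Sum>i\<in>I. \<Sum>j\<in>I. k i * (l j * v j)))"
    by (simp add: sum_distrib_left sum.distrib[symmetric] algebra_simps)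
  also have "\<dots> = M * ((\<Sum>i\<in>I. k i * u i) + (\<Sum>j\<in>I. l j * v j))"
    by (simp only: sum_product[symmetric] k1 l1 mult_1 mult_1_right)
  also have "\<dots> \<le> M * (pi / (2 * real K) + pi / (2 * real K))"
    using ku lv \<open>M \<ge> 0\<close> by (intro mult_left_mono add_mono)
  finally show ?thesis
    by simp
qed

section \<open>Boundedness and the error estimate\<close>

text \<open>In this range the denominator is at least half of \<open>\<kappa>\<^sup>2\<close>, well
  away from the removable singularity.\<close>

lemma norm_bessel_quotient_le:
  assumes "2 * (bessel_zero m n)\<^sup>2 < \<kappa>\<^sup>2"
  shows "\<bar>bessel_quotient m n \<kappa>\<bar> \<le> 2 / \<kappa>\<^sup>2"
proof -
  define z where "z = bessel_zero m n"
  have pos: "\<kappa>\<^sup>2 > 0" "\<kappa>\<^sup>2 / 2 \<le> \<kappa>\<^sup>2 - z\<^sup>2"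
    using assms zero_le_power2[of z] unfolding z_def by linarith+
  then have gap: "\<kappa>\<^sup>2 - z\<^sup>2 > 0"
    by linarith
  then have "\<kappa> \<noteq> z"
    by auto
  then have "\<bar>bessel_quotient m n \<kappa>\<bar> = \<bar>bessel_J m \<kappa>\<bar> / (\<kappa>\<^sup>2 - z\<^sup>2)"
    using gap by (simp add: bessel_quotient_def z_def[symmetric])
  also have "\<dots> \<le> 1 / (\<kappa>\<^sup>2 / 2)"
    using pos abs_bessel_J_le by (intro frac_le) auto
  finally show ?thesis
    by simp
qed

lemma freq_norm_power2: "(freq_norm k)\<^sup>2 = (real_of_int (fst k))\<^sup>2 + (real_of_int (snd k))\<^sup>2"
  by (simp add: freq_norm_def norm_Pair)

lemma finite_freq_norm_le: "finite {k. (freq_norm k)\<^sup>2 \<le> R}"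
proof -
  obtain N :: nat where N: "R \<le> real N"
    using real_arch_simple by blast
  have bound: "\<bar>j\<bar> \<le> int N" if "(real_of_int j)\<^sup>2 \<le> R" for j
  proof -
    have "real_of_int (j\<^sup>2) \<le> real_of_int (int N)"
      using that N by simp
    then have "j\<^sup>2 \<le> int N"
      by (simp only: of_int_le_iff)
    moreover have "\<bar>j\<bar> * 1 \<le> \<bar>j\<bar> * \<bar>j\<bar>"
      by (cases "j = 0") (simp, rule mult_left_mono, auto)
    ultimately show ?thesis
      by (simp add: power2_eq_square)
  qed
  have "{k. (freq_norm k)\<^sup>2 \<le> R} \<subseteq> freq_box N"
  proof
    fix k assume "k \<in> {k. (freq_norm k)\<^sup>2 \<le> R}"
    then have "(real_of_int (fst k))\<^sup>2 \<le> R" "(real_of_int (snd k))\<^sup>2 \<le> R"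
      using zero_le_power2[of "real_of_int (fst k)"] zero_le_power2[of "real_of_int (snd k)"]
      unfolding mem_Collect_eq freq_norm_power2 by linarith+
    then show "k \<in> freq_box N"
      using bound[of "fst k"] bound[of "snd k"] by (auto simp: freq_box_def mem_Times_iff)
  qed
  then show ?thesis
    using finite_freq_box finite_subset by blast
qed

lemma FFB_weight_decay:
  obtains C where "C \<ge> 0" "\<And>k. cmod (FFB_weight k m n) * (1 + (freq_norm k)\<^sup>2) \<le> C"
proof -
  define z where "z = bessel_zero m n"
  \<comment> \<open>Above \<open>2 * z\<^sup>2\<close> the quotient bound applies, as
    \<open>pi \<ge> 1\<close>; the extra 1 gives
    \<open>1 + (freq_norm k)\<^sup>2 \<le> 2 * (freq_norm k)\<^sup>2\<close>. Only finitely many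
    frequencies remain below \<open>R\<close>.\<close>
  define R where "R = 2 * z\<^sup>2 + 1"
  define h where "h = (\<lambda>k. cmod (FFB_weight k m n) * (1 + (freq_norm k)\<^sup>2))"
  have "finite (h ` {k. (freq_norm k)\<^sup>2 \<le> R})"
    by (intro finite_imageI finite_freq_norm_le)
  then have "bdd_above (h ` {k. (freq_norm k)\<^sup>2 \<le> R})"
    by (rule bdd_above_finite)
  then obtain C0 where C0: "\<And>k. (freq_norm k)\<^sup>2 \<le> R \<Longrightarrow> h k \<le> C0"
    unfolding bdd_above_def by blast
  define C1 where "C1 = sqrt pi * \<bar>z\<bar>"
  have "h k \<le> 2 * C1" if "(freq_norm k)\<^sup>2 > R" for k
  proof -
    have pi2: "1 \<le> pi\<^sup>2"
      using pi_ge_two by (simp add: one_le_power)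
    have big: "1 \<le> (freq_norm k)\<^sup>2" "2 * z\<^sup>2 < (freq_norm k)\<^sup>2"
      using that zero_le_power2[of z] unfolding R_def by linarith+
    have le: "(freq_norm k)\<^sup>2 \<le> (pi * freq_norm k)\<^sup>2"
      using mult_right_mono[OF pi2, of "(freq_norm k)\<^sup>2"] by (simp add: power_mult_distrib)
    then have "\<bar>bessel_quotient m n (pi * freq_norm k)\<bar> \<le> 2 / (pi * freq_norm k)\<^sup>2"
      using big by (intro norm_bessel_quotient_le) (auto simp: z_def)
    also have "\<dots> \<le> 2 / (freq_norm k)\<^sup>2"
      using big le by (intro divide_left_mono mult_pos_pos) auto
    finally have q: "\<bar>bessel_quotient m n (pi * freq_norm k)\<bar> \<le> 2 / (freq_norm k)\<^sup>2" .
    have "cmod (exp (- (\<i> * of_int m * of_real (freq_angle k)))) = 1"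
      by simp
    moreover have "\<bar>bessel_sign m\<bar> = 1"
      by (simp add: bessel_sign_def power_int_abs)
    ultimately have "cmod (FFB_weight k m n) = C1 * \<bar>bessel_quotient m n (pi * freq_norm k)\<bar> / 2"
      by (simp add: FFB_weight_def norm_mult norm_divide norm_power norm_power_int C1_def z_def)
    also have "\<dots> \<le> C1 * (2 / (freq_norm k)\<^sup>2) / 2"
      using q by (intro divide_right_mono mult_left_mono) (auto simp: C1_def)
    finally have "h k \<le> C1 * (2 / (freq_norm k)\<^sup>2) / 2 * (2 * (freq_norm k)\<^sup>2)"
      unfolding h_def using big by (intro mult_mono) (auto simp: C1_def)
    also have "\<dots> = 2 * C1"
    proof -
      have "(freq_norm k)\<^sup>2 \<noteq> 0"
        using big by linarith
      then show ?thesis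
        by simp
    qed
    finally show ?thesis .
  qed
  then have "h k \<le> max 0 (max C0 (2 * C1))" for k
    using C0[of k] by (cases "(freq_norm k)\<^sup>2 \<le> R") (simp_all add: le_max_iff_disj not_le)
  then show thesis
    using that[of "max 0 (max C0 (2 * C1))"] by (simp add: h_def)
qed

text \<open>The subtracted term carries the induction: the two new summands are compared with the
  telescoping difference \<open>2 / (K + 1) - 2 / (K + 2)\<close>.\<close>

lemma sum_inverse_square_int_le: "(\<Sum>j=- int K..int K. 1 / (1 + \<bar>real_of_int j\<bar>)\<^sup>2) \<le> 4 - 2 / real (K + 1)"
proof (induction K)
  case (Suc K)
  have "{- int (Suc K)..int (Suc K)} = insert (- int (Suc K)) (insert (int (Suc K)) {- int K..int K})"
    by auto
  then have "(\<Sum>j=- int (Suc K)..int (Suc K). 1 / (1 + \<bar>real_of_int j\<bar>)\<^sup>2)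
      = 2 / (real K + 2)\<^sup>2 + (\<Sum>j=- int K..int K. 1 / (1 + \<bar>real_of_int j\<bar>)\<^sup>2)"
    by (simp add: add_ac)
  also have "\<dots> \<le> 2 / ((real K + 1) * (real K + 2)) + (4 - 2 / real (K + 1))"
    by (intro add_mono Suc.IH divide_left_mono) (auto simp: power2_eq_square)
  also have "2 / ((real K + 1) * (real K + 2)) = 2 / (real K + 1) - 2 / (real K + 2)"
    by (simp add: field_simps)
  finally show ?case
    by (simp add: add_ac)
qed simp

text \<open>Since \<open>(1 + x) * (1 + y)\<close> is at most twice
  \<open>1 + x\<^sup>2 + y\<^sup>2\<close>, the squared weights are dominated by a product of two
  summable sequences in one variable each.\<close>

lemma FFB_weight_square_summable:
  obtains S where "\<And>K. (\<Sum>k\<in>freq_box K. (cmod (FFB_weight k m n))\<^sup>2) \<le> S"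
proof -
  obtain C where C: "C \<ge> 0" "\<And>k. cmod (FFB_weight k m n) * (1 + (freq_norm k)\<^sup>2) \<le> C"
    using FFB_weight_decay by blast
  define b where "b = (\<lambda>j::int. 1 / (1 + \<bar>real_of_int j\<bar>)\<^sup>2)"
  have "(cmod (FFB_weight k m n))\<^sup>2 \<le> (2 * C)\<^sup>2 * (b (fst k) * b (snd k))" for k
  proof -
    define x y where "x = \<bar>real_of_int (fst k)\<bar>" and "y = \<bar>real_of_int (snd k)\<bar>"
    have xy: "x \<ge> 0" "y \<ge> 0"
      by (simp_all add: x_def y_def)
    have "(1 + x) * (1 + y) \<le> 2 * (1 + (x\<^sup>2 + y\<^sup>2))"
    proof -
      \<comment> \<open>Three instances of the inequality of the means, with \<open>x * y\<close>,
        \<open>x\<^sup>2\<close> and \<open>y\<^sup>2\<close> abstracted to \<open>p\<close>,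
        \<open>q\<close> and \<open>r\<close> so that only linear arithmetic is left.\<close>
      have linear: "1 + x + y + p \<le> 2 * (1 + (q + r))"
        if "2 * p \<le> q + r" "2 * x \<le> q + 1" "2 * y \<le> r + 1" "0 \<le> q" "0 \<le> r" for p q r
        using that by argo
      have "(1 + x) * (1 + y) = 1 + x + y + x * y"
        by (simp add: algebra_simps)
      also have "\<dots> \<le> 2 * (1 + (x\<^sup>2 + y\<^sup>2))"
        using sum_squares_bound[of x y] sum_squares_bound[of x 1] sum_squares_bound[of y 1]
        by (intro linear) simp_all
      finally show ?thesis .
    qed
    then have "cmod (FFB_weight k m n) * ((1 + x) * (1 + y)) \<le> cmod (FFB_weight k m n) * (2 * (1 + (freq_norm k)\<^sup>2))"
      by (intro mult_left_mono) (auto simp: freq_norm_power2 x_def y_def)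
    also have "\<dots> \<le> 2 * C"
      using C(2)[of k] by (simp only: mult.left_commute[of _ 2] mult_le_cancel_left_pos zero_less_numeral)
    finally have "cmod (FFB_weight k m n) \<le> 2 * C / ((1 + x) * (1 + y))"
      using xy by (simp add: pos_le_divide_eq add_pos_nonneg)
    then have "(cmod (FFB_weight k m n))\<^sup>2 \<le> (2 * C / ((1 + x) * (1 + y)))\<^sup>2"
      by (intro power_mono) auto
    then show ?thesis
      by (simp add: b_def x_def y_def power_divide power_mult_distrib)
  qed
  then have "(\<Sum>k\<in>freq_box K. (cmod (FFB_weight k m n))\<^sup>2) \<le> (\<Sum>k\<in>freq_box K. (2 * C)\<^sup>2 * (b (fst k) * b (snd k)))" for K
    by (intro sum_mono)
  moreover have "(\<Sum>k\<in>freq_box K. (2 * C)\<^sup>2 * (b (fst k) * b (snd k))) \<le> (2 * C)\<^sup>2 * (4 * 4)" for K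
  proof -
    have "(\<Sum>j=- int K..int K. b j) \<le> 4 - 2 / real (K + 1)"
      unfolding b_def by (rule sum_inverse_square_int_le)
    then have "(\<Sum>j=- int K..int K. b j) \<le> 4"
      using divide_nonneg_nonneg[of 2 "real (K + 1)"] by linarith
    then have "(\<Sum>j=- int K..int K. b j) * (\<Sum>j=- int K..int K. b j) \<le> 4 * 4"
      by (intro mult_mono) (auto intro!: sum_nonneg simp: b_def)
    moreover have "(\<Sum>k\<in>freq_box K. b (fst k) * b (snd k)) = (\<Sum>j=- int K..int K. b j) * (\<Sum>j=- int K..int K. b j)"
      by (simp add: freq_box_def sum_product sum.cartesian_product split_beta)
    ultimately show ?thesis
      unfolding sum_distrib_left[symmetric] by (intro mult_left_mono) auto
  qed
  ultimately show thesis
    using that order_trans by blast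
qed

section \<open>Lipschitz bounds for the periodic distance\<close>

lemma sin_half_pi_ge:
  assumes "0 \<le> u" "u \<le> 1"
  shows "u \<le> sin (pi * u / 2)"
proof -
  \<comment> \<open>Jordan's inequality: a concave function lies above its chord, here the one from
    0 to \<open>pi / 2\<close>.\<close>
  have "concave_on {0..pi/2} sin"
    by (rule f''_le0_imp_concave[where f' = cos and f'' = "\<lambda>x. - sin x"])
       (auto intro!: derivative_eq_intros sin_ge_zero)
  from concave_onD_Icc[OF this, of u] assms show ?thesis
    by (simp add: mult_ac)
qed

text \<open>As \<open>g\<close> vanishes at both end points it is Lipschitz for the 2-periodic distance.\<close>
lemma periodic_Lipschitz:
  fixes g :: "real \<Rightarrow> complex"
  assumes deriv: "\<And>t. (g has_vector_derivative g' t) (at t)"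
    and M: "\<And>t. \<bar>t\<bar> \<le> 1 \<Longrightarrow> cmod (g' t) \<le> M"
    and ends: "g 1 = 0" "g (-1) = 0"
    and x: "\<bar>x\<bar> \<le> 1" "\<bar>x'\<bar> \<le> 1"
  shows "cmod (g x - g x') \<le> M * \<bar>sin (pi * (x - x') / 2)\<bar>"
proof -
  have lip: "cmod (g s - g t) \<le> M * \<bar>s - t\<bar>" if "\<bar>s\<bar> \<le> 1" "\<bar>t\<bar> \<le> 1" for s t
  proof -
    have "norm (g s - g t) \<le> M * norm (s - t)"
    proof (rule differentiable_bound[of "{-1..1}" g "\<lambda>t h. h *\<^sub>R g' t"])
      show "(g has_derivative (\<lambda>h. h *\<^sub>R g' t)) (at t within {-1..1})" for t
        using deriv[of t] unfolding has_vector_derivative_def by (rule has_derivative_at_withinI)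
      show "onorm (\<lambda>h. h *\<^sub>R g' t) \<le> M" if "t \<in> {-1..1}" for t
      proof (rule onorm_le)
        have "cmod (g' t) \<le> M"
          using that by (intro M) auto
        then show "norm (h *\<^sub>R g' t) \<le> M * norm h" for h
          by (simp add: mult.commute[of M] mult_left_mono)
      qed
    qed (use that in auto)
    then show ?thesis
      by simp
  qed
  have M0: "M \<ge> 0"
    using M[of 0] norm_ge_zero[of "g' 0"] by linarith
  have main: "cmod (g s - g t) \<le> M * \<bar>sin (pi * (s - t) / 2)\<bar>" if "\<bar>s\<bar> \<le> 1" "\<bar>t\<bar> \<le> 1" "t \<le> s" for s t
  proof (cases "s - t \<le> 1")
    case True
    then have "s - t \<le> \<bar>sin (pi * (s - t) / 2)\<bar>"
      using sin_half_pi_ge[of "s - t"] that by simp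
    moreover have "cmod (g s - g t) \<le> M * (s - t)"
      using lip[of s t] that by simp
    ultimately show ?thesis
      using M0 mult_left_mono order_trans by blast
  next
    case False
    \<comment> \<open>Here the way round through the end points \<open>1\<close> and
      \<open>-1\<close>, where \<open>g\<close> vanishes, is shorter; its length is
      \<open>2 - (s - t)\<close>, and the sine takes the same value for both lengths.\<close>
    then have "2 - (s - t) \<le> sin (pi * (2 - (s - t)) / 2)"
      using that by (intro sin_half_pi_ge) auto
    also have "sin (pi * (2 - (s - t)) / 2) = sin (pi * (s - t) / 2)"
      using sin_pi_minus[of "pi * (s - t) / 2"] by (simp add: field_simps)
    finally have "2 - (s - t) \<le> \<bar>sin (pi * (s - t) / 2)\<bar>"
      by linarith
    moreover have "cmod (g s - g t) \<le> cmod (g s - g 1) + cmod (g (-1) - g t)"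
      using norm_triangle_ineq[of "g s - g 1" "g (-1) - g t"] by (simp add: ends)
    then have "cmod (g s - g t) \<le> M * (2 - (s - t))"
      using lip[of s 1] lip[of "-1" t] that by (simp add: algebra_simps)
    ultimately show ?thesis
      using M0 mult_left_mono order_trans by blast
  qed
  show ?thesis
  proof (cases "x' \<le> x")
    case False
    have "pi * (x' - x) / 2 = - (pi * (x - x') / 2)"
      by (simp add: field_simps)
    then have "\<bar>sin (pi * (x' - x) / 2)\<bar> = \<bar>sin (pi * (x - x') / 2)\<bar>"
      by (simp only: sin_minus abs_minus_cancel)
    then show ?thesis
      using main[of x' x] x False by (simp add: norm_minus_commute)
  qed (use main x in auto)
qed

text \<open>One coordinate is changed at a time, with the partial derivatives bounded on the compact
  square. Points with \<open>\<bar>x\<bar> = 1\<close> or \<open>\<bar>y\<bar> = 1\<close> lie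
  outside the open disk, so \<open>f\<close> vanishes at the ends of each axis-parallel segment
  across the square.\<close>

lemma C_diff_periodic_Lipschitz:
  assumes "C_diff (Suc q) f" "supp f \<subseteq> ball 0 1"
  obtains M where "M \<ge> 0" "\<And>x x' y y'. \<lbrakk>\<bar>x\<bar> \<le> 1; \<bar>x'\<bar> \<le> 1; \<bar>y\<bar> \<le> 1; \<bar>y'\<bar> \<le> 1\<rbrakk> \<Longrightarrow>
      cmod (f (x, y) - f (x', y')) \<le> M * (\<bar>sin (pi * (x - x') / 2)\<bar> + \<bar>sin (pi * (y - y') / 2)\<bar>)"
proof -
  obtain f1 f2 where
    d1: "\<And>x y. ((\<lambda>t. f (t, y)) has_vector_derivative f1 (x, y)) (at x)" and
    d2: "\<And>x y. ((\<lambda>t. f (x, t)) has_vector_derivative f2 (x, y)) (at y)" and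
    C: "C_diff q f1" "C_diff q f2"
    using assms(1) by auto
  have cont: "continuous_on UNIV f1" "continuous_on UNIV f2"
    using C by (cases q; simp)+
  define Q :: "(real \<times> real) set" where "Q = {-1..1} \<times> {-1..1}"
  have "compact Q"
    by (simp add: Q_def compact_Times)
  then have bd: "\<exists>B. \<forall>p\<in>Q. cmod (h p) \<le> B" if "continuous_on UNIV h" for h :: "real \<times> real \<Rightarrow> complex"
    using compact_imp_bounded[OF compact_continuous_image[OF continuous_on_subset[OF that]], of Q]
    by (auto simp: bounded_iff)
  obtain M1 where M1: "\<And>p. p \<in> Q \<Longrightarrow> cmod (f1 p) \<le> M1"
    using bd[OF cont(1)] by blast
  obtain M2 where M2: "\<And>p. p \<in> Q \<Longrightarrow> cmod (f2 p) \<le> M2"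
    using bd[OF cont(2)] by blast
  define M where "M = max M1 M2"
  have M: "cmod (f1 p) \<le> M" "cmod (f2 p) \<le> M" if "p \<in> Q" for p
    using M1[OF that] M2[OF that] by (auto simp: M_def)
  have box: "(s, t) \<in> Q" if "\<bar>s\<bar> \<le> 1" "\<bar>t\<bar> \<le> 1" for s t
    using that by (auto simp: Q_def abs_le_iff)
  have "(0, 0) \<in> Q"
    by (simp add: Q_def)
  then have M0: "M \<ge> 0"
    by (rule order_trans[OF norm_ge_zero M(1)])
  have zero: "f (x, y) = 0" if "\<bar>x\<bar> = 1 \<or> \<bar>y\<bar> = 1" for x y
  proof (rule ccontr)
    assume "f (x, y) \<noteq> 0"
    then have "norm (x, y) < 1"
      using assms(2) by (auto simp: supp_def)
    then show False
      using that norm_fst_le[of x y] norm_snd_le[of y x] by auto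
  qed
  have "cmod (f (x, y) - f (x', y')) \<le> M * (\<bar>sin (pi * (x - x') / 2)\<bar> + \<bar>sin (pi * (y - y') / 2)\<bar>)"
    if "\<bar>x\<bar> \<le> 1" "\<bar>x'\<bar> \<le> 1" "\<bar>y\<bar> \<le> 1" "\<bar>y'\<bar> \<le> 1" for x x' y y'
  proof -
    have "cmod (f (x, y) - f (x', y)) \<le> M * \<bar>sin (pi * (x - x') / 2)\<bar>"
      by (rule periodic_Lipschitz[OF d1]) (use that M(1)[OF box] in \<open>auto simp: zero\<close>)
    moreover have "cmod (f (x', y) - f (x', y')) \<le> M * \<bar>sin (pi * (y - y') / 2)\<bar>"
      by (rule periodic_Lipschitz[OF d2]) (use that M(2)[OF box] in \<open>auto simp: zero\<close>)
    ultimately show ?thesis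
      using norm_triangle_ineq[of "f (x, y) - f (x', y)" "f (x', y) - f (x', y')"]
      by (simp add: distrib_left)
  qed
  with M0 that show thesis
    by blast
qed

theorem corollary3p7:
  fixes f :: "real \<times> real \<Rightarrow> complex" and m :: int and n :: nat
  assumes "C_diff 2 f"
    and "supp f \<subseteq> ball 0 1"
    and "n \<ge> 1"
  shows "\<exists>A>0. \<forall>K::nat. K \<ge> 1 \<and> int K \<ge> K_min m n \<longrightarrow>
           cmod (FB_coeff m n f - FFB_coeff K m n f) \<le> A / real K"
proof -
  have f: "C_diff (Suc 1) f"
    using assms(1) by (simp only: numeral_2_eq_2 One_nat_def)
  then have cont: "continuous_on UNIV f"
    by simp
  obtain M where M0: "M \<ge> 0" and M: "\<And>x x' y y'. \<lbrakk>\<bar>x\<bar> \<le> 1; \<bar>x'\<bar> \<le> 1; \<bar>y\<bar> \<le> 1; \<bar>y'\<bar> \<le> 1\<rbrakk> \<Longrightarrow>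
      cmod (f (x, y) - f (x', y')) \<le> M * (\<bar>sin (pi * (x - x') / 2)\<bar> + \<bar>sin (pi * (y - y') / 2)\<bar>)"
    using C_diff_periodic_Lipschitz[OF f assms(2)] by blast
  obtain S where S: "\<And>K. (\<Sum>k\<in>freq_box K. (cmod (FFB_weight k m n))\<^sup>2) \<le> S"
    using FFB_weight_square_summable by blast
  \<comment> \<open>\<open>R\<close> and \<open>4 * sqrt S\<close> bound the exact and the finite
    functional in the sup norm, both independently of \<open>K\<close>; the remaining factor
    \<open>M * pi\<close> of \<open>A\<close> comes from the approximation error.\<close>
  define R where "R = 2 * pi / (sqrt pi * \<bar>bessel_J (m + 1) (bessel_zero m n)\<bar>)"
  define A where "A = M * pi * (R + 4 * sqrt S)"
  have "cmod (FB_coeff m n f - FFB_coeff K m n f) \<le> A / real K" if K: "K \<ge> 1" for K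
  proof -
    define p where "p = FK_approx K f"
    define g where "g = (\<lambda>x. f x - p x)"
    define G where "G = M * pi / real K"
    have tp: "trig_poly K p"
      unfolding p_def by (rule trig_poly_FK_approx)
    have f_eq: "f = (\<lambda>x. g x + p x)"
      by (simp add: g_def)
    have contg: "continuous_on UNIV g"
      unfolding g_def by (intro continuous_on_diff cont trig_poly_continuous[OF tp])
    have G: "cmod (g (x, y)) \<le> G" if "\<bar>x\<bar> \<le> 1" "\<bar>y\<bar> \<le> 1" for x y
      unfolding g_def p_def G_def using FK_approx_error[OF K M that M0] .
    have G0: "G \<ge> 0"
      using M0 by (simp add: G_def)
    have "FB_coeff m n f - FFB_coeff K m n f = FB_coeff m n g - FFB_coeff K m n g"
      unfolding f_eq FFB_coeff_add FB_coeff_add[OF contg trig_poly_continuous[OF tp]]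
      using FB_coeff_trig_poly[OF tp assms(3)] by simp
    also have "cmod \<dots> \<le> cmod (FB_coeff m n g) + cmod (FFB_coeff K m n g)"
      by (rule norm_triangle_ineq4)
    also have "\<dots> \<le> G * R + 4 * G * sqrt S"
    proof (rule add_mono)
      show "cmod (FB_coeff m n g) \<le> G * R"
        using norm_FB_coeff_le[OF contg G, of m n] by (simp add: R_def mult_ac)
      have "cmod (FFB_coeff K m n g) \<le> 4 * G * sqrt (\<Sum>k\<in>freq_box K. (cmod (FFB_weight k m n))\<^sup>2)"
        by (intro norm_FFB_coeff_le G grid_point_abs_le)
      also have "\<dots> \<le> 4 * G * sqrt S"
        using S[of K] G0 by (intro mult_left_mono real_sqrt_le_mono) auto
      finally show "cmod (FFB_coeff K m n g) \<le> 4 * G * sqrt S" .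
    qed
    also have "\<dots> = A / real K"
      by (simp add: A_def G_def algebra_simps add_divide_distrib)
    finally show ?thesis .
  qed
  \<comment> \<open>\<open>A\<close> may be 0, for instance when \<open>M = 0\<close>, while the
    constant sought is strictly positive.\<close>
  moreover have "A / real K \<le> (\<bar>A\<bar> + 1) / real K" for K
    by (intro divide_right_mono) auto
  ultimately have "cmod (FB_coeff m n f - FFB_coeff K m n f) \<le> (\<bar>A\<bar> + 1) / real K" if "K \<ge> 1" for K
    using that by (rule_tac order_trans)
  then show ?thesis
    by (intro exI[of _ "\<bar>A\<bar> + 1"] conjI) auto
qed

end
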